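(* Let $\Theta\in(0,2\pi)$, put $\kappa=\frac{\sin\Theta}{1-\cos\Theta}$, let $\sigma\in[0,1]$, and let $I\subseteq\mathbb R$ be a finite interval containing at least one $E_j$. Let $\mu\in\mathbb R\setminus\{E_j: E_j\in I\}$ be a solution of $$\zeta_I(1,\mu)=\sigma\sum_{E_j\in I}(E_j-\kappa)\frac{|\Phi_j(p)|^2}{1+E_j^2},$$ and define $$\psi(x)=\sum_{E_j\in I}\frac{\overline{\Phi_j(p)}}{E_j-\mu}\Phi_j(x)+\sigma\sum_{E_j\notin I}(E_j-\kappa)\frac{\overline{\Phi_j(p)}}{1+E_j^2}\Phi_j(x).$$ Then the pair $(\psi,\mu)$ is a quasimode for $H_\Theta$ with discrepancy $d$, where $$d^2=\frac{(1-\sigma)^2\zeta_I(0,\mu)+\sigma^2\sum_{E_j\notin I}\bigl(1+E_j\mu+\kappa(E_j-\mu)\bigr)^2\frac{|\Phi_j(p)|^2}{(1+E_j^2)^2}}{\zeta_I(2,\mu)+\sigma^2\sum_{E_j\notin I}(E_j-\kappa)^2\frac{|\Phi_j(p)|^2}{(1+E_j^2)^2}}.$$ Furthermore, if $\mu_1\neq\mu_2$ in $\mathbb R\setminus\{E_j: E_j\in I\}$ satisfy $\zeta_I(1,\mu_k)=\sigma\sum_{E_j\in I}(E_j-\kappa)\frac{|\Phi_j(p)|^2}{1+E_j^2}$ for $k=1,2$ (same $\sigma$, $I$, $\Theta$), and $$\psi_k(x)=\sum_{E_j\in I}\frac{\overline{\Phi_j(p)}}{E_j-\mu_k}\Phi_j(x)+\sigma\sum_{E_j\notin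 I}(E_j-\kappa)\frac{\overline{\Phi_j(p)}}{1+E_j^2}\Phi_j(x),\qquad k=1,2,$$ then $$\langle\psi_1,\psi_2\rangle=\sigma^2\sum_{E_j\notin I}(E_j-\kappa)^2\frac{|\Phi_j(p)|^2}{(1+E_j^2)^2}.$$
   Context: Setting. $\mathcal M$ is a compact 2-dimensional Riemannian manifold, possibly with piecewise-smooth boundary, $\Delta$ is a self-adjoint Laplacian on $\mathcal M$, and $p\in\mathcal M$ is a fixed point. $\|\cdot\|$ and $\langle\cdot,\cdot\rangle$ are the norm and inner product (linear in the first argument) of $L^2(\mathcal M)$. $-\Delta$ has an orthonormal basis of eigenfunctions. In each eigenspace the orthonormal basis is chosen so that at most one basis element is nonzero at $p$; basis eigenfunctions vanishing at $p$ are discarded, and the remaining ones are denoted $\Phi_j$, with eigenvalues $E_1<E_2<E_3<\cdots$ (so $\Phi_j(p)\neq0$ and each $E_j$ is listed once). Weyl's law is a standing fact: $N(E):=\sum_{E_j\le E}|\Phi_j(p)|^2=\frac{E}{4\pi}+O(E^{1/2})$. All sums over $E_j\in I$ or $E_j\notin I$ run over this list. Notation: $\zeta_I(s,\lambda):=\sum_{E_j\in I}\frac{|\Phi_j(p)|^2}{(E_j-\lambda)^s}$. The operator $H_\Theta$. Let $g_{\pm i}:=\sum_{j\ge1}\frac{\overline{\Phi_j(p)}}{E_j\mp i}\Phi_j\in L^2(\mathcal M)$, $\mathcal D_p:=\{f\in\mathrm{Dom}(\Delta): f(p)=0\}$, and let $H_0$ be the symmetric operator $f\mapsto-\Delta f$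 with domain $\mathcal D_p$. Its deficiency subspaces are spanned by $g_{i}$ and $g_{-i}$, so $\mathrm{Dom}(H_0^* )=\mathcal D_p\oplus\mathrm{span}\{g_i,g_{-i}\}$; every $\psi\in\mathrm{Dom}(H_0^* )$ is uniquely $\psi=\hat\psi+a_+(\psi)g_i+a_-(\psi)g_{-i}$ with $\hat\psi\in\mathcal D_p$, $a_\pm(\psi)\in\mathbb C$, and $H_0^*\psi=H_0\hat\psi+i\,a_+(\psi)g_i-i\,a_-(\psi)g_{-i}$. $H_\Theta$ is the self-adjoint restriction of $H_0^*$ to $\mathrm{Dom}(H_\Theta)=\{\psi\in\mathrm{Dom}(H_0^* ): a_-(\psi)=-e^{i\Theta}a_+(\psi)\}$. Quasimode. A quasimode of a self-adjoint operator $H$ with discrepancy $d$ is a pair $(\psi,\mu)\in\mathrm{Dom}(H)\times\mathbb R$ with $\|(H-\mu)\psi\|\le d\|\psi\|$. *)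

theory Defs
  imports "HOL-Analysis.Analysis" "HOL-Library.Landau_Symbols"
begin

section \<open>Compact Riemannian surfaces with piecewise smooth boundary\<close>

(* C^infinity on an open set: differentiable at every point, and all partial derivatives are
   again C^infinity. *)
coinductive smooth_on ::
  "'a::euclidean_space set \<Rightarrow> ('a \<Rightarrow> 'b::real_normed_vector) \<Rightarrow> bool" for S where
  "\<lbrakk>\<forall>x\<in>S. f differentiable (at x);
    \<forall>b\<in>Basis. smooth_on S (\<lambda>x. frechet_derivative f (at x) b)\<rbrakk>
   \<Longrightarrow> smooth_on S f"

definition partial :: "2 \<Rightarrow> (real^2 \<Rightarrow> 'b::real_normed_vector) \<Rightarrow> real^2 \<Rightarrow> 'b" where
  "partial i f x = frechet_derivative f (at x) (axis i 1)"

type_synonym 'm chart = "'m set \<times> ('m \<Rightarrow> real^2)"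

definition coord_inv :: "'m chart \<Rightarrow> real^2 \<Rightarrow> 'm" where
  "coord_inv c = inv_into (fst c) (snd c)"

definition transition :: "'m chart \<Rightarrow> 'm chart \<Rightarrow> real^2 \<Rightarrow> real^2" where
  "transition c c' = snd c' \<circ> coord_inv c"

(* The type 'm is a smooth surface without boundary, not assumed compact, with Riemannian metric
   tensor G c x in the chart c at the coordinate point x. *)
locale riemannian_surface =
  fixes atlas :: "('m::{t2_space, second_countable_topology}) chart set"
    and G :: "'m chart \<Rightarrow> real^2 \<Rightarrow> real^2^2"
  assumes charts_cover: "(\<Union>c\<in>atlas. fst c) = UNIV"
    and chart_open: "\<And>U \<phi>. (U, \<phi>) \<in> atlas \<Longrightarrow> open U \<and> open (\<phi> ` U)"
    and chart_homeo: "\<And>U \<phi>. (U, \<phi>) \<in> atlas \<Longrightarrow> \<exists>\<eta>. homeomorphism U (\<phi> ` U) \<phi> \<eta>"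
    and transition_smooth:
      "\<And>U \<phi> V \<eta>. (U, \<phi>) \<in> atlas \<Longrightarrow> (V, \<eta>) \<in> atlas \<Longrightarrow>
         smooth_on (\<phi> ` (U \<inter> V)) (transition (U, \<phi>) (V, \<eta>))"
    and metric_smooth: "\<And>U \<phi>. (U, \<phi>) \<in> atlas \<Longrightarrow> smooth_on (\<phi> ` U) (G (U, \<phi>))"
    and metric_symmetric:
      "\<And>U \<phi> x. (U, \<phi>) \<in> atlas \<Longrightarrow> x \<in> \<phi> ` U \<Longrightarrow> transpose (G (U, \<phi>) x) = G (U, \<phi>) x"
    and metric_positive:
      "\<And>U \<phi> x v. (U, \<phi>) \<in> atlas \<Longrightarrow> x \<in> \<phi> ` U \<Longrightarrow> v \<noteq> 0 \<Longrightarrow> v \<bullet> (G (U, \<phi>) x *v v) > 0"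
    and metric_compatible:
      "\<And>U \<phi> V \<eta> x J. (U, \<phi>) \<in> atlas \<Longrightarrow> (V, \<eta>) \<in> atlas \<Longrightarrow> x \<in> \<phi> ` (U \<inter> V) \<Longrightarrow>
         J = matrix (frechet_derivative (transition (U, \<phi>) (V, \<eta>)) (at x)) \<Longrightarrow>
         G (U, \<phi>) x = transpose J ** G (V, \<eta>) (transition (U, \<phi>) (V, \<eta>) x) ** J"

(* A regular C^infinity curve [0,1] -> 'm, smooth up to and across its end points. *)
definition smooth_regular_curve :: "('m::topological_space) chart set \<Rightarrow> (real \<Rightarrow> 'm) \<Rightarrow> bool" where
  "smooth_regular_curve atlas \<gamma> \<longleftrightarrow>
     (\<exists>J. open J \<and> {0..1} \<subseteq> J \<and> continuous_on J \<gamma> \<and>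
       (\<forall>(U, \<phi>)\<in>atlas. smooth_on {t\<in>J. \<gamma> t \<in> U} (\<phi> \<circ> \<gamma>) \<and>
          (\<forall>t\<in>J. \<gamma> t \<in> U \<longrightarrow> vector_derivative (\<phi> \<circ> \<gamma>) (at t) \<noteq> 0)))"

(* M is a compact surface with (possibly empty) piecewise smooth boundary, realised inside the
   boundaryless surface 'm; the boundary of M is its frontier. M = UNIV gives the closed case. *)
locale compact_surface = riemannian_surface atlas G
  for atlas :: "('m::{t2_space, second_countable_topology}) chart set"
    and G :: "'m chart \<Rightarrow> real^2 \<Rightarrow> real^2^2" +
  fixes M :: "'m set"
  assumes M_compact: "compact M"
    and M_regular: "closure (interior M) = M"
    and M_manifold_with_boundary:
      "\<And>x. x \<in> M \<Longrightarrow> \<exists>V W. openin (top_of_set M) V \<and> x \<in> V \<and>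
         openin (top_of_set {z::real^2. 0 \<le> z $ 1}) W \<and> V homeomorphic W"
    and piecewise_smooth_boundary:
      "\<exists>\<Gamma>. finite \<Gamma> \<and> (\<forall>\<gamma>\<in>\<Gamma>. smooth_regular_curve atlas \<gamma>) \<and> frontier M = (\<Union>\<gamma>\<in>\<Gamma>. \<gamma> ` {0..1})"

definition riemannian_measure ::
  "('m::topological_space) chart set \<Rightarrow> ('m chart \<Rightarrow> real^2 \<Rightarrow> real^2^2) \<Rightarrow> 'm set \<Rightarrow> 'm measure \<Rightarrow> bool"
  where
  "riemannian_measure atlas G M vol \<longleftrightarrow>
     space vol = M \<and> sets vol = sets (restrict_space borel M) \<and>
     (\<forall>(U, \<phi>)\<in>atlas. \<forall>A\<in>sets borel. A \<subseteq> U \<inter> M \<longrightarrow>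
        emeasure vol A = (\<integral>\<^sup>+x\<in>\<phi> ` A. ennreal (sqrt (det (G (U, \<phi>) x))) \<partial>lborel))"

definition laplace_beltrami_coord ::
  "(real^2 \<Rightarrow> real^2^2) \<Rightarrow> (real^2 \<Rightarrow> complex) \<Rightarrow> real^2 \<Rightarrow> complex" where
  "laplace_beltrami_coord g u x =
     (\<Sum>i\<in>UNIV. partial i (\<lambda>y. \<Sum>j\<in>UNIV.
        (sqrt (det (g y)) * (matrix_inv (g y) $ i $ j)) *\<^sub>R partial j u y) x)
     /\<^sub>R sqrt (det (g x))"

definition test_function :: "('m::topological_space) chart set \<Rightarrow> 'm set \<Rightarrow> ('m \<Rightarrow> complex) \<Rightarrow> bool" where
  "test_function atlas M f \<longleftrightarrow>
     compact (closure {x. f x \<noteq> 0}) \<and> closure {x. f x \<noteq> 0} \<subseteq> interior M \<and>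
     (\<forall>(U, \<phi>)\<in>atlas. smooth_on (\<phi> ` U) (f \<circ> coord_inv (U, \<phi>)))"


section \<open>The Hilbert space of square integrable functions and unbounded operators\<close>

(* Elements of L^2 are represented by functions; equality in L^2 is equality almost everywhere. *)

definition l2 :: "'m measure \<Rightarrow> ('m \<Rightarrow> complex) set" where
  "l2 vol = {f \<in> borel_measurable vol. integrable vol (\<lambda>x. (cmod (f x))\<^sup>2)}"

definition l2_inner :: "'m measure \<Rightarrow> ('m \<Rightarrow> complex) \<Rightarrow> ('m \<Rightarrow> complex) \<Rightarrow> complex" where
  "l2_inner vol f g = (\<integral>x. f x * cnj (g x) \<partial>vol)"

definition l2_norm :: "'m measure \<Rightarrow> ('m \<Rightarrow> complex) \<Rightarrow> real" where
  "l2_norm vol f = sqrt (\<integral>x. (cmod (f x))\<^sup>2 \<partial>vol)"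

definition has_l2_sum ::
  "'m measure \<Rightarrow> ('i \<Rightarrow> 'm \<Rightarrow> complex) \<Rightarrow> 'i set \<Rightarrow> ('m \<Rightarrow> complex) \<Rightarrow> bool" where
  "has_l2_sum vol f J s \<longleftrightarrow> s \<in> l2 vol \<and>
     ((\<lambda>F. l2_norm vol (\<lambda>x. (\<Sum>j\<in>F. f j x) - s x)) \<longlongrightarrow> 0) (finite_subsets_at_top J)"

(* The sum of a series in L^2 (unconditional convergence in norm), determined almost everywhere. *)
definition l2_infsum :: "'m measure \<Rightarrow> ('i \<Rightarrow> 'm \<Rightarrow> complex) \<Rightarrow> 'i set \<Rightarrow> 'm \<Rightarrow> complex" where
  "l2_infsum vol f J = (SOME s. has_l2_sum vol f J s)"

(* An operator is given by its graph, which contains with (f, g) every pair that is almost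
   everywhere equal to it. *)
type_synonym 'm l2_operator = "(('m \<Rightarrow> complex) \<times> ('m \<Rightarrow> complex)) set"

definition l2_adjoint :: "'m measure \<Rightarrow> 'm l2_operator \<Rightarrow> 'm l2_operator" where
  "l2_adjoint vol T = {(g, h). g \<in> l2 vol \<and> h \<in> l2 vol \<and>
     (\<forall>(u, v)\<in>T. l2_inner vol v g = l2_inner vol u h)}"

definition l2_dense :: "'m measure \<Rightarrow> ('m \<Rightarrow> complex) set \<Rightarrow> bool" where
  "l2_dense vol S \<longleftrightarrow> S \<subseteq> l2 vol \<and>
     (\<forall>f\<in>l2 vol. \<forall>\<epsilon>>0. \<exists>h\<in>S. l2_norm vol (\<lambda>x. f x - h x) < \<epsilon>)"

definition l2_self_adjoint :: "'m measure \<Rightarrow> 'm l2_operator \<Rightarrow> bool" where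
  "l2_self_adjoint vol T \<longleftrightarrow> l2_dense vol (Domain T) \<and> l2_adjoint vol T = T"

definition l2_deficiency :: "'m measure \<Rightarrow> 'm l2_operator \<Rightarrow> complex \<Rightarrow> ('m \<Rightarrow> complex) set" where
  "l2_deficiency vol T z = {h. (h, \<lambda>x. z * h x) \<in> l2_adjoint vol T}"

definition l2_span1 :: "'m measure \<Rightarrow> ('m \<Rightarrow> complex) \<Rightarrow> ('m \<Rightarrow> complex) set" where
  "l2_span1 vol g = {h \<in> l2 vol. \<exists>a. AE x in vol. h x = a * g x}"

definition l2_orthonormal_basis :: "'m measure \<Rightarrow> ('m \<Rightarrow> complex) set \<Rightarrow> bool" where
  "l2_orthonormal_basis vol B \<longleftrightarrow> B \<subseteq> l2 vol \<and>
     (\<forall>b\<in>B. \<forall>c\<in>B. l2_inner vol b c = (if b = c then 1 else 0)) \<and>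
     (\<forall>f\<in>l2 vol. (\<forall>b\<in>B. l2_inner vol f b = 0) \<longrightarrow> (AE x in vol. f x = 0))"

definition quasimode ::
  "'m measure \<Rightarrow> 'm l2_operator \<Rightarrow> ('m \<Rightarrow> complex) \<Rightarrow> real \<Rightarrow> real \<Rightarrow> bool" where
  "quasimode vol H \<psi> \<mu> d \<longleftrightarrow>
     (\<exists>h. (\<psi>, h) \<in> H \<and> l2_norm vol (\<lambda>x. h x - of_real \<mu> * \<psi> x) \<le> d * l2_norm vol \<psi>)"


section \<open>The Laplacian and the point scatterer\<close>

(* Self-adjoint realisations of the Laplacian: the self-adjoint extensions of the Laplace-Beltrami
   operator on the smooth functions with compact support in the interior of M. *)
definition self_adjoint_laplacian ::
  "('m::topological_space) chart set \<Rightarrow> ('m chart \<Rightarrow> real^2 \<Rightarrow> real^2^2) \<Rightarrow> 'm set \<Rightarrow> 'm measure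
   \<Rightarrow> 'm l2_operator \<Rightarrow> bool" where
  "self_adjoint_laplacian atlas G M vol Lap \<longleftrightarrow> l2_self_adjoint vol Lap \<and>
     (\<forall>f. test_function atlas M f \<longrightarrow>
       (\<exists>g. (f, g) \<in> Lap \<and>
         (\<forall>c\<in>atlas. \<forall>x\<in>fst c \<inter> M.
            g x = laplace_beltrami_coord (G c) (f \<circ> coord_inv c) (snd c x))))"

(* f(p) = 0 for an element f of L^2, evaluated through a representative that is continuous at p. *)
definition vanishes_at ::
  "('m::t2_space) set \<Rightarrow> 'm measure \<Rightarrow> 'm \<Rightarrow> ('m \<Rightarrow> complex) \<Rightarrow> bool" where
  "vanishes_at M vol p f \<longleftrightarrow>
     (\<exists>f'. (AE x in vol. f' x = f x) \<and> continuous (at p within M) f' \<and> f' p = 0)"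

(* The restriction of minus the Laplacian to the functions vanishing at p. *)
definition H0 ::
  "('m::t2_space) set \<Rightarrow> 'm measure \<Rightarrow> 'm l2_operator \<Rightarrow> 'm \<Rightarrow> 'm l2_operator" where
  "H0 M vol Lap p = {(f, \<lambda>x. - g x) | f g. (f, g) \<in> Lap \<and> vanishes_at M vol p f}"

(* greens z is g_i for z = i and g_{-i} for z = -i. *)
definition greens ::
  "'m measure \<Rightarrow> 'm \<Rightarrow> (nat \<Rightarrow> 'm \<Rightarrow> complex) \<Rightarrow> (nat \<Rightarrow> real) \<Rightarrow> complex \<Rightarrow> 'm \<Rightarrow> complex" where
  "greens vol p \<Phi> E z =
     l2_infsum vol (\<lambda>j x. cnj (\<Phi> j p) / (of_real (E j) - z) * \<Phi> j x) UNIV"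

(* psi = f + a g_i + b g_{-i} with f in the domain of H0, i.e. a = a_+(psi) and b = a_-(psi). *)
definition deficiency_decomposition ::
  "('m::t2_space) set \<Rightarrow> 'm measure \<Rightarrow> 'm l2_operator \<Rightarrow> 'm \<Rightarrow> (nat \<Rightarrow> 'm \<Rightarrow> complex) \<Rightarrow> (nat \<Rightarrow> real)
   \<Rightarrow> ('m \<Rightarrow> complex) \<Rightarrow> ('m \<Rightarrow> complex) \<Rightarrow> complex \<Rightarrow> complex \<Rightarrow> bool" where
  "deficiency_decomposition M vol Lap p \<Phi> E \<psi> f a b \<longleftrightarrow>
     f \<in> Domain (H0 M vol Lap p) \<and>
     (AE x in vol. \<psi> x = f x + a * greens vol p \<Phi> E \<i> x + b * greens vol p \<Phi> E (- \<i>) x)"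

definition H_Theta ::
  "('m::t2_space) set \<Rightarrow> 'm measure \<Rightarrow> 'm l2_operator \<Rightarrow> 'm \<Rightarrow> (nat \<Rightarrow> 'm \<Rightarrow> complex) \<Rightarrow> (nat \<Rightarrow> real)
   \<Rightarrow> real \<Rightarrow> 'm l2_operator" where
  "H_Theta M vol Lap p \<Phi> E \<Theta> =
     {(\<psi>, h) \<in> l2_adjoint vol (H0 M vol Lap p).
        \<exists>f a b. deficiency_decomposition M vol Lap p \<Phi> E \<psi> f a b \<and> b = - exp (\<i> * of_real \<Theta>) * a}"

(* B is the full orthonormal eigenbasis, with representatives continuous at p; \<Phi> 0, \<Phi> 1, ... are
   its elements that do not vanish at p. Since E is strictly increasing, each eigenspace contains
   at most one of them. *)
locale point_scatterer = compact_surface atlas G M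
  for atlas :: "('m::{t2_space, second_countable_topology}) chart set"
    and G :: "'m chart \<Rightarrow> real^2 \<Rightarrow> real^2^2"
    and M :: "'m set" +
  fixes vol :: "'m measure" and Lap :: "'m l2_operator" and p :: 'm
    and B :: "('m \<Rightarrow> complex) set" and \<Phi> :: "nat \<Rightarrow> 'm \<Rightarrow> complex" and E :: "nat \<Rightarrow> real"
  assumes vol: "riemannian_measure atlas G M vol"
    and Lap: "self_adjoint_laplacian atlas G M vol Lap"
    and p: "p \<in> M"
    and basis: "l2_orthonormal_basis vol B"
    and basis_eigen: "\<And>b. b \<in> B \<Longrightarrow> \<exists>e::real. (b, \<lambda>x. - (of_real e * b x)) \<in> Lap"
    and basis_continuous: "\<And>b. b \<in> B \<Longrightarrow> continuous (at p within M) b"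
    and Phi_enum: "bij_betw \<Phi> UNIV {b \<in> B. b p \<noteq> 0}"
    and Phi_eigen: "\<And>j. (\<Phi> j, \<lambda>x. - (of_real (E j) * \<Phi> j x)) \<in> Lap"
    and E_strict: "strict_mono E"
    and weyl: "(\<lambda>t. (\<Sum>\<^sub>\<infinity>j\<in>{j. E j \<le> t}. (cmod (\<Phi> j p))\<^sup>2) - t / (4 * pi)) \<in> O(\<lambda>t. sqrt t)"
    and deficiency_plus:
      "l2_deficiency vol (H0 M vol Lap p) \<i> = l2_span1 vol (greens vol p \<Phi> E \<i>)"
    and deficiency_minus:
      "l2_deficiency vol (H0 M vol Lap p) (- \<i>) = l2_span1 vol (greens vol p \<Phi> E (- \<i>))"

definition zeta ::
  "'m \<Rightarrow> (nat \<Rightarrow> 'm \<Rightarrow> complex) \<Rightarrow> (nat \<Rightarrow> real) \<Rightarrow> real set \<Rightarrow> nat \<Rightarrow> real \<Rightarrow> real" where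
  "zeta p \<Phi> E I s \<mu> = (\<Sum>\<^sub>\<infinity>j\<in>{j. E j \<in> I}. (cmod (\<Phi> j p))\<^sup>2 / (E j - \<mu>) ^ s)"

definition psi ::
  "'m measure \<Rightarrow> 'm \<Rightarrow> (nat \<Rightarrow> 'm \<Rightarrow> complex) \<Rightarrow> (nat \<Rightarrow> real)
   \<Rightarrow> real \<Rightarrow> real \<Rightarrow> real set \<Rightarrow> real \<Rightarrow> 'm \<Rightarrow> complex" where
  "psi vol p \<Phi> E \<kappa> \<sigma> I \<mu> = (\<lambda>x.
     (\<Sum>j | E j \<in> I. cnj (\<Phi> j p) / of_real (E j - \<mu>) * \<Phi> j x) +
     of_real \<sigma> * l2_infsum vol
       (\<lambda>j x. of_real (E j - \<kappa>) * (cnj (\<Phi> j p) / of_real (1 + (E j)\<^sup>2)) * \<Phi> j x) {j. E j \<notin> I} x)"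

end

(* With a = sigma / (1 - exp (i Theta)) and b = - exp (i Theta) a, the combination a g_i + b g_-i has
   the coefficients sigma (E_j - kappa) / (1 + E_j^2) times the conjugate of Phi_j(p). Hence
   psi - a g_i - b g_-i is a finite combination of the Phi_j with E_j in I, and the equation for mu
   says that it vanishes at p. So psi lies in the domain of H_Theta, the coefficients of
   (H_Theta - mu) psi are explicit, and Parseval's identity shows that the discrepancy is attained.
   The Weyl law makes I contain finitely many eigenvalues and makes the weights
   |Phi_j(p)|^2 / (1 + E_j^2) summable, so that all L^2 series converge by Riesz--Fischer. For two
   roots, the contributions from I to the inner product telescope to
   (zeta(mu_1) - zeta(mu_2)) / (mu_1 - mu_2) = 0. *)
theory Submission
  imports Defs "HOL-Real_Asymp.Real_Asymp"
begin

section \<open>Square integrable functions\<close>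

text \<open>An element of L^2 is a plain function here, and a series is a choice made by
  \<open>SOME\<close>. Nothing is known about \<open>greens\<close> or \<open>psi\<close> until some
  sum is shown to exist, and two sums of one series agree only almost everywhere. Completeness
  therefore comes from a concrete almost everywhere limit, and identities between series reduce to
  equality of coefficients followed by uniqueness of sums. The number kappa is cot(Theta/2) = -i (1
  + z) / (1 - z) with z = exp(i Theta); this is why the real weights sigma (E_j - kappa) are
  compatible with the boundary condition b = -z a. On I the sigma terms of the residual collapse,
  because E (E - kappa) + (1 + kappa E) = 1 + E^2. They leave 1 - sigma times the conjugate of
  Phi_j(p), hence the term with zeta_I(0, mu). Thus sigma = 1 removes the residual on I, and sigma =
  0 removes it off I.\<close>

lemma l2_borel: "f \<in> l2 N \<Longrightarrow> f \<in> borel_measurable N"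
  by (simp add: l2_def)

lemma l2_integrable_inner:
  assumes "f \<in> l2 N" "g \<in> l2 N"
  shows "integrable N (\<lambda>x. f x * cnj (g x))"
proof (rule Bochner_Integration.integrable_bound)
  show "integrable N (\<lambda>x. (cmod (f x))\<^sup>2 + (cmod (g x))\<^sup>2)"
    using assms by (auto simp: l2_def)
  show "(\<lambda>x. f x * cnj (g x)) \<in> borel_measurable N"
    using assms by (auto simp: l2_def intro!: borel_measurable_times
        measurable_compose[OF _ borel_measurable_continuous_onI[OF continuous_on_cnj[OF continuous_on_id]]])
  have "cmod z * cmod w \<le> (cmod z)\<^sup>2 + (cmod w)\<^sup>2" for z w
    using sum_squares_bound[of "cmod z" "cmod w"] mult_nonneg_nonneg[OF norm_ge_zero[of z] norm_ge_zero[of w]]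
    by linarith
  then show "AE x in N. norm (f x * cnj (g x)) \<le> norm ((cmod (f x))\<^sup>2 + (cmod (g x))\<^sup>2)"
    by (auto simp: norm_mult)
qed

lemma l2_cmult:
  assumes "f \<in> l2 N"
  shows "(\<lambda>x. c * f x) \<in> l2 N"
  using assms by (auto simp: l2_def norm_mult power_mult_distrib)

lemma l2_add:
  assumes "f \<in> l2 N" "g \<in> l2 N"
  shows "(\<lambda>x. f x + g x) \<in> l2 N"
proof -
  have "integrable N (\<lambda>x. (cmod (f x + g x))\<^sup>2)"
  proof (rule Bochner_Integration.integrable_bound)
    show "integrable N (\<lambda>x. 2 * (cmod (f x))\<^sup>2 + 2 * (cmod (g x))\<^sup>2)"
      using assms by (auto simp: l2_def)
    show "(\<lambda>x. (cmod (f x + g x))\<^sup>2) \<in> borel_measurable N"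
      using assms by (auto simp: l2_def)
    have "(cmod (z + w))\<^sup>2 \<le> 2 * (cmod z)\<^sup>2 + 2 * (cmod w)\<^sup>2" for z w
      using power_mono[OF norm_triangle_ineq[of z w], of 2] sum_squares_bound[of "cmod z" "cmod w"]
      by (simp add: power2_sum)
    then show "AE x in N. norm ((cmod (f x + g x))\<^sup>2) \<le> norm (2 * (cmod (f x))\<^sup>2 + 2 * (cmod (g x))\<^sup>2)"
      by auto
  qed
  then show ?thesis using assms by (auto simp: l2_def)
qed

lemma l2_diff:
  assumes "f \<in> l2 N" "g \<in> l2 N"
  shows "(\<lambda>x. f x - g x) \<in> l2 N"
  using l2_add[OF assms(1) l2_cmult[OF assms(2), of "-1"]] by simp

lemma l2_zero: "(\<lambda>x. 0) \<in> l2 N"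
  by (simp add: l2_def)

lemma l2_sum:
  assumes "\<And>j. j \<in> F \<Longrightarrow> f j \<in> l2 N"
  shows "(\<lambda>x. \<Sum>j\<in>F. f j x) \<in> l2 N"
  using assms by (induction F rule: infinite_finite_induct) (auto simp: l2_zero l2_add)

section \<open>Sesquilinear inner product and norm\<close>

lemma l2_inner_add_left:
  assumes "f \<in> l2 N" "g \<in> l2 N" "k \<in> l2 N"
  shows "l2_inner N (\<lambda>x. f x + g x) k = l2_inner N f k + l2_inner N g k"
  using assms by (simp add: l2_inner_def distrib_right l2_integrable_inner)

lemma l2_inner_diff_left:
  assumes "f \<in> l2 N" "g \<in> l2 N" "k \<in> l2 N"
  shows "l2_inner N (\<lambda>x. f x - g x) k = l2_inner N f k - l2_inner N g k"
  using assms by (simp add: l2_inner_def left_diff_distrib l2_integrable_inner)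

lemma l2_inner_cmult_left: "l2_inner N (\<lambda>x. c * f x) k = c * l2_inner N f k"
  by (simp add: l2_inner_def mult.assoc)

lemma l2_inner_commute: "l2_inner N g f = cnj (l2_inner N f g)"
proof -
  have "l2_inner N g f = (\<integral>x. cnj (f x * cnj (g x)) \<partial>N)"
    by (simp add: l2_inner_def mult.commute)
  then show ?thesis by (simp only: Bochner_Integration.integral_cnj l2_inner_def)
qed

lemma l2_inner_add_right:
  assumes "f \<in> l2 N" "g \<in> l2 N" "k \<in> l2 N"
  shows "l2_inner N k (\<lambda>x. f x + g x) = l2_inner N k f + l2_inner N k g"
  using l2_inner_add_left[OF assms] by (simp add: l2_inner_commute[where g=k])

lemma l2_inner_diff_right:
  assumes "f \<in> l2 N" "g \<in> l2 N" "k \<in> l2 N"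
  shows "l2_inner N k (\<lambda>x. f x - g x) = l2_inner N k f - l2_inner N k g"
  using l2_inner_diff_left[OF assms] by (simp add: l2_inner_commute[where g=k])

lemma l2_inner_cmult_right: "l2_inner N k (\<lambda>x. c * f x) = cnj c * l2_inner N k f"
  by (simp add: l2_inner_commute[where g=k] l2_inner_cmult_left)

lemma l2_inner_sum_left:
  assumes "\<And>j. j \<in> F \<Longrightarrow> f j \<in> l2 N" "k \<in> l2 N"
  shows "l2_inner N (\<lambda>x. \<Sum>j\<in>F. f j x) k = (\<Sum>j\<in>F. l2_inner N (f j) k)"
  using assms
  by (induction F rule: infinite_finite_induct) (auto simp: l2_inner_add_left l2_sum l2_inner_def[of _ "\<lambda>x. 0"])

lemma l2_inner_sum_right:
  assumes "\<And>j. j \<in> F \<Longrightarrow> f j \<in> l2 N" "k \<in> l2 N"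
  shows "l2_inner N k (\<lambda>x. \<Sum>j\<in>F. f j x) = (\<Sum>j\<in>F. l2_inner N k (f j))"
  by (simp add: l2_inner_commute[where g=k] l2_inner_sum_left[of F f N k, OF assms])

lemma l2_norm_nonneg: "l2_norm N f \<ge> 0"
  by (simp add: l2_norm_def)

lemma l2_norm_square: "(l2_norm N f)\<^sup>2 = (\<integral>x. (cmod (f x))\<^sup>2 \<partial>N)"
  by (simp add: l2_norm_def)

lemma l2_inner_self: "l2_inner N f f = of_real ((l2_norm N f)\<^sup>2)"
  unfolding l2_norm_square l2_inner_def complex_norm_square[symmetric]
  by (rule integral_complex_of_real)

lemma l2_norm_minus_commute: "l2_norm N (\<lambda>x. f x - g x) = l2_norm N (\<lambda>x. g x - f x)"
  by (simp add: l2_norm_def norm_minus_commute)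

lemma l2_norm_cmult: "l2_norm N (\<lambda>x. c * f x) = cmod c * l2_norm N f"
  by (simp add: l2_norm_def norm_mult power_mult_distrib real_sqrt_mult)

text \<open>The parallelogram identity serves as triangle inequality. It needs only the expansion of
  inner products, and the factor 2 is harmless in limit arguments.\<close>

lemma l2_norm_add_square_le:
  assumes "f \<in> l2 N" "g \<in> l2 N"
  shows "(l2_norm N (\<lambda>x. f x + g x))\<^sup>2 \<le> 2 * (l2_norm N f)\<^sup>2 + 2 * (l2_norm N g)\<^sup>2"
proof -
  have "(l2_norm N (\<lambda>x. f x + g x))\<^sup>2 + (l2_norm N (\<lambda>x. f x - g x))\<^sup>2
      = 2 * (l2_norm N f)\<^sup>2 + 2 * (l2_norm N g)\<^sup>2"
  proof -
    have "complex_of_real ((l2_norm N (\<lambda>x. f x + g x))\<^sup>2 + (l2_norm N (\<lambda>x. f x - g x))\<^sup>2)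
      = of_real (2 * (l2_norm N f)\<^sup>2 + 2 * (l2_norm N g)\<^sup>2)"
      unfolding of_real_add of_real_mult l2_inner_self[symmetric]
      using assms by (simp add: l2_inner_add_left l2_inner_add_right l2_inner_diff_left l2_inner_diff_right l2_add l2_diff)
    then show ?thesis by (simp only: of_real_eq_iff)
  qed
  then show ?thesis using zero_le_power2[of "l2_norm N (\<lambda>x. f x - g x)"] by linarith
qed

lemma l2_norm_eq_0_AE:
  assumes "f \<in> l2 N" "l2_norm N f = 0"
  shows "AE x in N. f x = 0"
proof -
  have "(\<integral>x. (cmod (f x))\<^sup>2 \<partial>N) = 0"
    using assms(2) by (simp add: l2_norm_def)
  then have "AE x in N. (cmod (f x))\<^sup>2 = 0"
    using assms(1) integral_nonneg_eq_0_iff_AE[of N "\<lambda>x. (cmod (f x))\<^sup>2"] by (simp add: l2_def)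
  then show ?thesis by auto
qed

text \<open>Inner products ignore null sets. This carries membership in an adjoint over to
  \<open>psi\<close>, which equals its deficiency decomposition only almost everywhere.\<close>

lemma l2_adjoint_cong:
  assumes "(g, h) \<in> l2_adjoint N T" "g' \<in> l2 N" "AE x in N. g' x = g x" "fst ` T \<subseteq> l2 N" "snd ` T \<subseteq> l2 N"
  shows "(g', h) \<in> l2_adjoint N T"
proof -
  have "l2_inner N v g' = l2_inner N u h" if "(u, v) \<in> T" for u v
  proof -
    have v: "v \<in> l2 N" using that assms(5) by force
    have g: "g \<in> l2 N" using assms(1) by (simp add: l2_adjoint_def)
    have "l2_inner N v g' = l2_inner N v g"
      unfolding l2_inner_def
      by (rule Bochner_Integration.integral_cong_AE)
        (use v g assms(2,3) in \<open>auto intro!: borel_measurable_integrable[OF l2_integrable_inner]\<close>)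
    then show ?thesis using that assms(1) by (auto simp: l2_adjoint_def)
  qed
  then show ?thesis using assms by (auto simp: l2_adjoint_def)
qed

section \<open>Linear structure of adjoint graphs\<close>

lemma l2_adjoint_add:
  assumes "(g, h) \<in> l2_adjoint N T" "(g', h') \<in> l2_adjoint N T" "T \<subseteq> l2 N \<times> l2 N"
  shows "(\<lambda>x. g x + g' x, \<lambda>x. h x + h' x) \<in> l2_adjoint N T"
proof -
  have "l2_inner N v (\<lambda>x. g x + g' x) = l2_inner N u (\<lambda>x. h x + h' x)" if "(u, v) \<in> T" for u v
  proof -
    have "l2_inner N v g = l2_inner N u h" "l2_inner N v g' = l2_inner N u h'"
      using assms(1,2) that by (auto simp: l2_adjoint_def)
    then show ?thesis
      using assms(1,2) subsetD[OF assms(3) that] by (auto simp: l2_adjoint_def l2_inner_add_right)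
  qed
  then show ?thesis using assms(1,2) by (auto simp: l2_adjoint_def l2_add)
qed

lemma l2_adjoint_cmult:
  assumes "(g, h) \<in> l2_adjoint N T"
  shows "(\<lambda>x. c * g x, \<lambda>x. c * h x) \<in> l2_adjoint N T"
  using assms by (auto simp: l2_adjoint_def l2_inner_cmult_right l2_cmult)

lemma l2_adjoint_sum:
  assumes "finite F" "\<And>j. j \<in> F \<Longrightarrow> (g j, h j) \<in> l2_adjoint N T" "T \<subseteq> l2 N \<times> l2 N"
  shows "(\<lambda>x. \<Sum>j\<in>F. g j x, \<lambda>x. \<Sum>j\<in>F. h j x) \<in> l2_adjoint N T"
  using assms
proof (induction F rule: finite_induct)
  case empty
  then show ?case by (simp add: l2_adjoint_def l2_zero l2_inner_def)
next
  case (insert j F)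
  then show ?case by (simp add: l2_adjoint_add)
qed

section \<open>Unconditional sums and orthonormal systems\<close>

text \<open>The parallelogram bound and Parseval's identity speak of squared norms, so convergence
  is tested on squares.\<close>

lemma has_l2_sum_iff_square:
  "has_l2_sum N f J s \<longleftrightarrow> s \<in> l2 N \<and>
     ((\<lambda>F. (l2_norm N (\<lambda>x. (\<Sum>j\<in>F. f j x) - s x))\<^sup>2) \<longlongrightarrow> 0) (finite_subsets_at_top J)"
proof -
  have "((\<lambda>F. (g F)\<^sup>2) \<longlongrightarrow> 0) A \<Longrightarrow> (g \<longlongrightarrow> 0) A" for g :: "'b \<Rightarrow> real" and A
    using tendsto_real_sqrt[of "\<lambda>F. (g F)\<^sup>2" 0 A] by (simp add: tendsto_rabs_zero_iff)
  then show ?thesis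
    unfolding has_l2_sum_def using tendsto_power[of _ "0::real" _ 2] by auto
qed

lemma has_l2_sum_l2: "has_l2_sum N f J s \<Longrightarrow> s \<in> l2 N"
  by (simp add: has_l2_sum_def)

lemma has_l2_sum_cong:
  assumes "has_l2_sum N f J s" "\<And>j x. j \<in> J \<Longrightarrow> f j x = g j x"
  shows "has_l2_sum N g J s"
proof -
  have "\<forall>\<^sub>F F in finite_subsets_at_top J.
      l2_norm N (\<lambda>x. (\<Sum>j\<in>F. f j x) - s x) = l2_norm N (\<lambda>x. (\<Sum>j\<in>F. g j x) - s x)"
    using assms(2) by (intro eventually_finite_subsets_at_top_weakI) (simp add: subset_iff cong: sum.cong)
  then show ?thesis
    using assms(1) tendsto_cong unfolding has_l2_sum_def by fastforce
qed

text \<open>This is the only way to compare sums chosen by \<open>SOME\<close>: both are limits of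
  the same partial sums, so their distance is 0.\<close>

lemma has_l2_sum_unique:
  assumes "has_l2_sum N f J s" "has_l2_sum N f J t" "\<And>j. j \<in> J \<Longrightarrow> f j \<in> l2 N"
  shows "AE x in N. s x = t x"
proof -
  have st: "s \<in> l2 N" "t \<in> l2 N" using assms by (auto simp: has_l2_sum_def)
  let ?P = "\<lambda>F x. \<Sum>j\<in>F. f j x"
  have "(l2_norm N (\<lambda>x. s x - t x))\<^sup>2 \<le> 0"
  proof (rule tendsto_le)
    show "((\<lambda>F. (l2_norm N (\<lambda>x. s x - t x))\<^sup>2) \<longlongrightarrow> (l2_norm N (\<lambda>x. s x - t x))\<^sup>2) (finite_subsets_at_top J)"
      by simp
    show "((\<lambda>F. 2 * (l2_norm N (\<lambda>x. ?P F x - s x))\<^sup>2 + 2 * (l2_norm N (\<lambda>x. ?P F x - t x))\<^sup>2) \<longlongrightarrow> 0)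
        (finite_subsets_at_top J)"
      using assms(1,2) unfolding has_l2_sum_iff_square by (auto intro!: tendsto_eq_intros)
    have "(l2_norm N (\<lambda>x. s x - t x))\<^sup>2 \<le>
        2 * (l2_norm N (\<lambda>x. ?P F x - s x))\<^sup>2 + 2 * (l2_norm N (\<lambda>x. ?P F x - t x))\<^sup>2"
      if "F \<subseteq> J" for F
    proof -
      have P: "?P F \<in> l2 N" using assms(3) that by (intro l2_sum) auto
      show ?thesis
        using l2_norm_add_square_le[OF l2_diff[OF st(1) P] l2_diff[OF P st(2)]] l2_norm_minus_commute[of N s "?P F"]
        by simp
    qed
    then show "\<forall>\<^sub>F F in finite_subsets_at_top J. (l2_norm N (\<lambda>x. s x - t x))\<^sup>2 \<le>
        2 * (l2_norm N (\<lambda>x. ?P F x - s x))\<^sup>2 + 2 * (l2_norm N (\<lambda>x. ?P F x - t x))\<^sup>2"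
      by (intro eventually_finite_subsets_at_top_weakI) auto
  qed simp
  then have "l2_norm N (\<lambda>x. s x - t x) = 0" by simp
  from l2_norm_eq_0_AE[OF l2_diff[OF st] this] show ?thesis by simp
qed

lemma has_l2_sum_cmult:
  assumes "has_l2_sum N f J s"
  shows "has_l2_sum N (\<lambda>j x. c * f j x) J (\<lambda>x. c * s x)"
proof -
  have "((\<lambda>F. cmod c * l2_norm N (\<lambda>x. (\<Sum>j\<in>F. f j x) - s x)) \<longlongrightarrow> 0) (finite_subsets_at_top J)"
    using assms unfolding has_l2_sum_def by (auto intro!: tendsto_eq_intros)
  then show ?thesis
    using assms by (simp add: has_l2_sum_def l2_cmult l2_norm_cmult[symmetric] right_diff_distrib sum_distrib_left)
qed

lemma has_l2_sum_add:
  assumes "has_l2_sum N f J s" "has_l2_sum N g J t"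
    and l2: "\<And>j. j \<in> J \<Longrightarrow> f j \<in> l2 N" "\<And>j. j \<in> J \<Longrightarrow> g j \<in> l2 N"
  shows "has_l2_sum N (\<lambda>j x. f j x + g j x) J (\<lambda>x. s x + t x)"
proof -
  let ?P = "\<lambda>F x. \<Sum>j\<in>F. f j x" and ?Q = "\<lambda>F x. \<Sum>j\<in>F. g j x"
  have st: "s \<in> l2 N" "t \<in> l2 N" using assms by (auto simp: has_l2_sum_def)
  have "((\<lambda>F. (l2_norm N (\<lambda>x. (\<Sum>j\<in>F. f j x + g j x) - (s x + t x)))\<^sup>2) \<longlongrightarrow> 0) (finite_subsets_at_top J)"
  proof (rule tendsto_sandwich[OF _ _ tendsto_const])
    show "((\<lambda>F. 2 * (l2_norm N (\<lambda>x. ?P F x - s x))\<^sup>2 + 2 * (l2_norm N (\<lambda>x. ?Q F x - t x))\<^sup>2) \<longlongrightarrow> 0)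
        (finite_subsets_at_top J)"
      using assms(1,2) unfolding has_l2_sum_iff_square by (auto intro!: tendsto_eq_intros)
    have "(l2_norm N (\<lambda>x. (\<Sum>j\<in>F. f j x + g j x) - (s x + t x)))\<^sup>2 \<le>
        2 * (l2_norm N (\<lambda>x. ?P F x - s x))\<^sup>2 + 2 * (l2_norm N (\<lambda>x. ?Q F x - t x))\<^sup>2"
      if "F \<subseteq> J" for F
    proof -
      have PQ: "?P F \<in> l2 N" "?Q F \<in> l2 N" using l2 that by (auto intro!: l2_sum)
      show ?thesis
        using l2_norm_add_square_le[OF l2_diff[OF PQ(1) st(1)] l2_diff[OF PQ(2) st(2)]]
        by (simp add: sum.distrib algebra_simps)
    qed
    then show "\<forall>\<^sub>F F in finite_subsets_at_top J.
        (l2_norm N (\<lambda>x. (\<Sum>j\<in>F. f j x + g j x) - (s x + t x)))\<^sup>2 \<le>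
        2 * (l2_norm N (\<lambda>x. ?P F x - s x))\<^sup>2 + 2 * (l2_norm N (\<lambda>x. ?Q F x - t x))\<^sup>2"
      by (intro eventually_finite_subsets_at_top_weakI) auto
  qed simp
  then show ?thesis by (simp add: has_l2_sum_iff_square l2_add st)
qed

lemma has_l2_sum_finite_Un:
  assumes "has_l2_sum N f J s" "finite K" "K \<inter> J = {}" "\<And>j. j \<in> K \<Longrightarrow> f j \<in> l2 N"
  shows "has_l2_sum N f (K \<union> J) (\<lambda>x. (\<Sum>j\<in>K. f j x) + s x)"
proof -
  let ?g = "\<lambda>F. l2_norm N (\<lambda>x. (\<Sum>j\<in>F. f j x) - s x)"
  let ?h = "\<lambda>F. l2_norm N (\<lambda>x. (\<Sum>j\<in>F. f j x) - ((\<Sum>j\<in>K. f j x) + s x))"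
  \<comment> \<open>Deleting \<open>K\<close> turns a finite subset of \<open>K \<union> J\<close>
    into a finite subset of \<open>J\<close>, eventually one above any prescribed \<open>X\<close>.
    The limit along \<open>J\<close> can thus be pulled back.\<close>
  have "filterlim (\<lambda>F. F - K) (finite_subsets_at_top J) (finite_subsets_at_top (K \<union> J))"
    unfolding filterlim_finite_subsets_at_top
  proof safe
    fix X assume X: "finite X" "X \<subseteq> J"
    show "\<forall>\<^sub>F y in finite_subsets_at_top (K \<union> J). finite (y - K) \<and> X \<subseteq> y - K \<and> y - K \<subseteq> J"
      unfolding eventually_finite_subsets_at_top
      by (rule exI[of _ X]) (use X assms(3) in auto)
  qed
  then have "((\<lambda>F. ?g (F - K)) \<longlongrightarrow> 0) (finite_subsets_at_top (K \<union> J))"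
    by (rule filterlim_compose[rotated]) (use assms(1) in \<open>simp add: has_l2_sum_def\<close>)
  moreover have "\<forall>\<^sub>F F in finite_subsets_at_top (K \<union> J). ?g (F - K) = ?h F"
    \<comment> \<open>As soon as \<open>F\<close> contains \<open>K\<close>, the finite sum over
      \<open>K\<close> cancels from the difference.\<close>
    unfolding eventually_finite_subsets_at_top
  proof (intro exI[of _ K] conjI allI impI)
    fix F assume "finite F \<and> K \<subseteq> F \<and> F \<subseteq> K \<union> J"
    then have "(\<Sum>j\<in>F. f j x) = (\<Sum>j\<in>F - K. f j x) + (\<Sum>j\<in>K. f j x)" for x
      by (intro sum.subset_diff) auto
    then show "?g (F - K) = ?h F" by (simp add: algebra_simps)
  qed (use assms in auto)
  ultimately have "(?h \<longlongrightarrow> 0) (finite_subsets_at_top (K \<union> J))"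
    using tendsto_cong by fast
  then show ?thesis
    using assms(4) has_l2_sum_l2[OF assms(1)] by (auto simp: has_l2_sum_def intro!: l2_add l2_sum)
qed

lemma has_l2_sum_zero: "has_l2_sum N (\<lambda>j x. 0) J (\<lambda>x. 0)"
  by (simp add: has_l2_sum_def l2_zero l2_norm_def)

text \<open>The choice in \<open>l2_infsum\<close> means something only once some sum exists;
  \<open>Riesz_Fischer\<close> supplies one for each series used below.\<close>

lemma has_l2_sum_l2_infsum:
  assumes "has_l2_sum N f J s"
  shows "has_l2_sum N f J (l2_infsum N f J)"
  unfolding l2_infsum_def by (rule someI[of "has_l2_sum N f J", OF assms])

text \<open>An indexed family without completeness, unlike \<open>l2_orthonormal_basis\<close>: the
  Phi_j omit the basis elements that vanish at p.\<close>

definition l2_orthonormal :: "'m measure \<Rightarrow> ('i \<Rightarrow> 'm \<Rightarrow> complex) \<Rightarrow> bool" where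
  "l2_orthonormal N e \<longleftrightarrow> range e \<subseteq> l2 N \<and> (\<forall>i j. l2_inner N (e i) (e j) = (if i = j then 1 else 0))"

lemma l2_orthonormal_l2: "l2_orthonormal N e \<Longrightarrow> e j \<in> l2 N"
  by (auto simp: l2_orthonormal_def)

section \<open>Coefficients, Bessel's inequality and Parseval's identity\<close>

lemma l2_inner_orthonormal_sum:
  assumes "l2_orthonormal N e" "finite F"
  shows "l2_inner N (\<lambda>x. \<Sum>j\<in>F. c j * e j x) (e i) = (if i \<in> F then c i else 0)"
  using assms
  by (simp add: l2_inner_sum_left l2_cmult l2_orthonormal_l2 l2_inner_cmult_left l2_orthonormal_def
      if_distrib[of "\<lambda>z. _ * z"] cong: if_cong) 

lemma l2_inner_orthonormal_sums:
  assumes "l2_orthonormal N e" "finite F"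
  shows "l2_inner N (\<lambda>x. \<Sum>j\<in>F. c j * e j x) (\<lambda>x. \<Sum>j\<in>F. d j * e j x) = (\<Sum>j\<in>F. c j * cnj (d j))"
proof -
  have "(\<lambda>x. \<Sum>j\<in>F. c j * e j x) \<in> l2 N"
    by (intro l2_sum l2_cmult l2_orthonormal_l2[OF assms(1)])
  then show ?thesis
    using assms
    by (simp add: l2_inner_sum_right l2_cmult l2_orthonormal_l2 l2_inner_cmult_right
      l2_inner_orthonormal_sum mult.commute)
qed

lemma l2_norm_orthonormal_sum:
  assumes "l2_orthonormal N e" "finite F"
  shows "(l2_norm N (\<lambda>x. \<Sum>j\<in>F. c j * e j x))\<^sup>2 = (\<Sum>j\<in>F. (cmod (c j))\<^sup>2)"
proof -
  have "complex_of_real ((l2_norm N (\<lambda>x. \<Sum>j\<in>F. c j * e j x))\<^sup>2) = of_real (\<Sum>j\<in>F. (cmod (c j))\<^sup>2)"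
    unfolding l2_inner_self[symmetric] l2_inner_orthonormal_sums[OF assms]
    by (simp add: complex_norm_square del: of_real_power)
  then show ?thesis by (simp only: of_real_eq_iff)
qed

text \<open>Subtracting from f its component along \<open>e i\<close> leaves a square norm of |f|^2
  - |c|^2, which cannot be negative. The bound makes each coefficient continuous in norm.\<close>

lemma l2_Bessel:
  assumes "l2_orthonormal N e" "f \<in> l2 N"
  shows "cmod (l2_inner N f (e i)) \<le> l2_norm N f"
proof -
  have e: "e i \<in> l2 N" "l2_inner N (e i) (e i) = 1" using assms by (auto simp: l2_orthonormal_def)
  define c where "c = l2_inner N f (e i)"
  have "complex_of_real ((l2_norm N (\<lambda>x. f x - c * e i x))\<^sup>2) = of_real ((l2_norm N f)\<^sup>2 - (cmod c)\<^sup>2)"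
    unfolding l2_inner_self[symmetric] of_real_diff
    using assms e
    by (simp add: l2_inner_diff_left l2_inner_diff_right l2_diff l2_cmult l2_inner_cmult_left
        l2_inner_cmult_right c_def[symmetric] l2_inner_commute[of N "e i" f] complex_norm_square del: of_real_power)
  then have "(l2_norm N (\<lambda>x. f x - c * e i x))\<^sup>2 = (l2_norm N f)\<^sup>2 - (cmod c)\<^sup>2"
    by (simp only: of_real_eq_iff)
  then have "(cmod c)\<^sup>2 \<le> (l2_norm N f)\<^sup>2"
    using zero_le_power2[of "l2_norm N (\<lambda>x. f x - c * e i x)"] by linarith
  then show ?thesis unfolding c_def by (rule power2_le_imp_le) (rule l2_norm_nonneg)
qed

lemma has_l2_sum_coeff:
  assumes e: "l2_orthonormal N e" and s: "has_l2_sum N (\<lambda>j x. c j * e j x) J s"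
  shows "l2_inner N s (e i) = (if i \<in> J then c i else 0)"
proof -
  let ?P = "\<lambda>F x. \<Sum>j\<in>F. c j * e j x"
  have P: "?P F \<in> l2 N" for F by (intro l2_sum l2_cmult l2_orthonormal_l2[OF e])
  have sl: "s \<in> l2 N" using s by (rule has_l2_sum_l2)
  have lim: "((\<lambda>F. l2_norm N (\<lambda>x. ?P F x - s x)) \<longlongrightarrow> 0) (finite_subsets_at_top J)"
    using s by (simp add: has_l2_sum_def)
  have "((\<lambda>F. l2_inner N (?P F) (e i) - l2_inner N s (e i)) \<longlongrightarrow> 0) (finite_subsets_at_top J)"
  proof (rule Lim_null_comparison[OF _ lim], rule always_eventually, rule allI)
    show "norm (l2_inner N (?P F) (e i) - l2_inner N s (e i)) \<le> l2_norm N (\<lambda>x. ?P F x - s x)" for F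
      using l2_Bessel[OF e l2_diff[OF P sl]] by (simp add: l2_inner_diff_left[OF P sl l2_orthonormal_l2[OF e]])
  qed
  moreover have "\<forall>\<^sub>F F in finite_subsets_at_top J. l2_inner N (?P F) (e i) - l2_inner N s (e i)
      = (if i \<in> J then c i else 0) - l2_inner N s (e i)"
    \<comment> \<open>The witness \<open>J \<inter> {i}\<close> treats both cases at once: if i lies
      in \<open>J\<close>, then eventually i lies in \<open>F\<close>; otherwise it never
      does.\<close>
    unfolding eventually_finite_subsets_at_top
    by (rule exI[of _ "J \<inter> {i}"]) (auto simp: l2_inner_orthonormal_sum[OF e])
  ultimately have "((\<lambda>F. (if i \<in> J then c i else 0) - l2_inner N s (e i)) \<longlongrightarrow> 0) (finite_subsets_at_top J)"
    using tendsto_cong by fast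
  then show ?thesis by (simp add: tendsto_const_iff)
qed

text \<open>Completeness plays no part here because s is itself a sum over the family. Its
  coefficients are known, so |s|^2 exceeds the partial sum of squares by exactly the squared
  distance to the partial sum, which tends to 0.\<close>

lemma has_l2_sum_Parseval:
  assumes e: "l2_orthonormal N e" and s: "has_l2_sum N (\<lambda>j x. c j * e j x) J s"
  shows "((\<lambda>j. (cmod (c j))\<^sup>2) has_sum (l2_norm N s)\<^sup>2) J"
proof -
  let ?P = "\<lambda>F x. \<Sum>j\<in>F. c j * e j x"
  have P: "?P F \<in> l2 N" for F by (intro l2_sum l2_cmult l2_orthonormal_l2[OF e])
  have sl: "s \<in> l2 N" using s by (rule has_l2_sum_l2)
  have eq: "(l2_norm N s)\<^sup>2 - (l2_norm N (\<lambda>x. ?P F x - s x))\<^sup>2 = (\<Sum>j\<in>F. (cmod (c j))\<^sup>2)"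
    if F: "finite F" "F \<subseteq> J" for F
  proof -
    have sP: "l2_inner N s (?P F) = of_real (\<Sum>j\<in>F. (cmod (c j))\<^sup>2)"
      using F sl e
      by (simp add: l2_inner_sum_right l2_cmult l2_orthonormal_l2 l2_inner_cmult_right
        has_l2_sum_coeff[OF e s] subset_iff complex_norm_square mult.commute del: of_real_power cong: sum.cong)
    have PP: "l2_inner N (?P F) (?P F) = of_real (\<Sum>j\<in>F. (cmod (c j))\<^sup>2)"
      using F l2_norm_orthonormal_sum[OF e, of F c] by (simp add: l2_inner_self)
    have "complex_of_real ((l2_norm N s)\<^sup>2 - (l2_norm N (\<lambda>x. ?P F x - s x))\<^sup>2) = of_real (\<Sum>j\<in>F. (cmod (c j))\<^sup>2)"
      unfolding l2_inner_self[symmetric] of_real_diff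
      using P sl sP PP l2_inner_commute[of N "?P F" s]
      by (simp add: l2_inner_diff_left l2_inner_diff_right l2_diff)
    then show ?thesis by (simp only: of_real_eq_iff)
  qed
  have "((\<lambda>F. (l2_norm N s)\<^sup>2 - (l2_norm N (\<lambda>x. ?P F x - s x))\<^sup>2) \<longlongrightarrow> (l2_norm N s)\<^sup>2 - 0) (finite_subsets_at_top J)"
    using s unfolding has_l2_sum_iff_square by (intro tendsto_diff tendsto_const) auto
  moreover have "\<forall>\<^sub>F F in finite_subsets_at_top J.
      (l2_norm N s)\<^sup>2 - (l2_norm N (\<lambda>x. ?P F x - s x))\<^sup>2 = (\<Sum>j\<in>F. (cmod (c j))\<^sup>2)"
    by (intro eventually_finite_subsets_at_top_weakI) (rule eq)
  ultimately show ?thesis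
    unfolding has_sum_def using tendsto_cong by fastforce
qed

section \<open>The Riesz--Fischer theorem\<close>

text \<open>Fatou's lemma. The bound is asked for only from K on because a lower limit forgets
  initial terms; finiteness of the integral puts \<open>s - f\<close>, hence s, into L^2.\<close>

lemma l2_norm_AE_limit_le:
  assumes T: "\<And>k. T k \<in> l2 N" and f: "f \<in> l2 N" and s: "s \<in> borel_measurable N"
    and lim: "AE x in N. (\<lambda>k. T k x) \<longlonglongrightarrow> s x"
    and bound: "\<And>k. k \<ge> K \<Longrightarrow> (l2_norm N (\<lambda>x. T k x - f x))\<^sup>2 \<le> b"
  shows "s \<in> l2 N" "(l2_norm N (\<lambda>x. s x - f x))\<^sup>2 \<le> b"
proof -
  have b0: "b \<ge> 0" using bound[of K] by (meson order.refl order.trans zero_le_power2)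
  have l2D: "(\<lambda>x. T k x - f x) \<in> l2 N" for k using l2_diff[OF T f] .
  have nn: "(\<integral>\<^sup>+x. ennreal ((cmod (s x - f x))\<^sup>2) \<partial>N) \<le> ennreal b"
  proof -
    have "(\<integral>\<^sup>+x. ennreal ((cmod (s x - f x))\<^sup>2) \<partial>N) =
        (\<integral>\<^sup>+x. liminf (\<lambda>k. ennreal ((cmod (T k x - f x))\<^sup>2)) \<partial>N)"
    proof (rule nn_integral_cong_AE)
      show "AE x in N. ennreal ((cmod (s x - f x))\<^sup>2) = liminf (\<lambda>k. ennreal ((cmod (T k x - f x))\<^sup>2))"
        using lim
      proof eventually_elim
        case (elim x)
        then have "(\<lambda>k. ennreal ((cmod (T k x - f x))\<^sup>2)) \<longlonglongrightarrow> ennreal ((cmod (s x - f x))\<^sup>2)"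
          by (intro tendsto_intros)
        from lim_imp_Liminf[OF _ this] show ?case by simp
      qed
    qed
    also have "\<dots> \<le> liminf (\<lambda>k. \<integral>\<^sup>+x. ennreal ((cmod (T k x - f x))\<^sup>2) \<partial>N)"
      using l2_borel[OF T] l2_borel[OF f] by (intro nn_integral_liminf) auto
    also have "\<dots> \<le> ennreal b"
    proof (rule Liminf_le)
      show "\<forall>\<^sub>F k in sequentially. (\<integral>\<^sup>+x. ennreal ((cmod (T k x - f x))\<^sup>2) \<partial>N) \<le> ennreal b"
        unfolding eventually_sequentially
      proof (intro exI[of _ K] allI impI)
        fix k assume "K \<le> k"
        have "(\<integral>\<^sup>+x. ennreal ((cmod (T k x - f x))\<^sup>2) \<partial>N) = ennreal (\<integral>x. (cmod (T k x - f x))\<^sup>2 \<partial>N)"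
          using l2D[of k] by (intro nn_integral_eq_integral) (auto simp: l2_def)
        also have "\<dots> \<le> ennreal b"
          using bound[OF \<open>K \<le> k\<close>] by (simp add: l2_norm_square ennreal_leI)
        finally show "(\<integral>\<^sup>+x. ennreal ((cmod (T k x - f x))\<^sup>2) \<partial>N) \<le> ennreal b" .
      qed
    qed simp
    finally show ?thesis .
  qed
  have meas: "(\<lambda>x. (cmod (s x - f x))\<^sup>2) \<in> borel_measurable N" using s l2_borel[OF f] by auto
  have int: "integrable N (\<lambda>x. (cmod (s x - f x))\<^sup>2)"
    using nn meas by (intro integrableI_nonneg) (auto simp: less_top[symmetric] top_unique)
  then have sf: "(\<lambda>x. s x - f x) \<in> l2 N" using s l2_borel[OF f] by (auto simp: l2_def)
  from l2_add[OF this f] show "s \<in> l2 N" by simp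
  show "(l2_norm N (\<lambda>x. s x - f x))\<^sup>2 \<le> b"
    using nn b0 nn_integral_eq_integral[OF int] by (simp add: l2_norm_square)
qed

text \<open>Zero coefficients outside \<open>J\<close> make ordinary sequences of partial sums
  available. A fast subsequence converges almost everywhere; Fatou's lemma then bounds the distance
  from its limit to every initial partial sum by a tail, and orthogonality extends this to unordered
  finite index sets.\<close>

theorem Riesz_Fischer:
  fixes c :: "nat \<Rightarrow> complex"
  assumes e: "l2_orthonormal N e" and c: "(\<lambda>j. (cmod (c j))\<^sup>2) summable_on J"
  shows "\<exists>s. has_l2_sum N (\<lambda>j x. c j * e j x) J s"
proof -
  define d where "d j = (if j \<in> J then c j else 0)" for j
  define a where "a j = (cmod (d j))\<^sup>2" for j
  have a0: "a j \<ge> 0" for j by (simp add: a_def)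
  have "a summable_on UNIV"
    using c summable_on_cong_neutral[where S=J and T=UNIV and f="\<lambda>j. (cmod (c j))\<^sup>2" and g=a]
    by (simp add: a_def d_def)
  then have a: "summable a" by (rule summable_on_imp_summable)
  define tl where "tl n = (\<Sum>j. a (j + n))" for n
  have tl: "tl \<longlonglongrightarrow> 0" unfolding tl_def using suminf_exist_split2[OF a] by simp
  \<comment> \<open>Arbitrary finite sets beyond n are allowed, since the goal is convergence along
    all finite subsets and not only along initial segments.\<close>
  have tl_ge: "sum a F \<le> tl n" if "finite F" "F \<subseteq> {n..}" for F n
  proof -
    have "sum a F = sum (\<lambda>j. a (j + n)) ((\<lambda>j. j - n) ` F)"
      using that by (intro sum.reindex_bij_witness[where i="\<lambda>j. j + n" and j="\<lambda>j. j - n"]) auto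
    also have "\<dots> \<le> tl n"
      unfolding tl_def using a a0 that by (intro sum_le_suminf) auto
    finally show ?thesis .
  qed
  define S where "S F x = (\<Sum>j\<in>F. d j * e j x)" for F x
  have S: "S F \<in> l2 N" for F
    unfolding S_def by (intro l2_sum l2_cmult l2_orthonormal_l2[OF e])
  have S_diff: "(l2_norm N (\<lambda>x. S F x - S {..<n} x))\<^sup>2 \<le> tl n" if "finite F" "{..<n} \<subseteq> F" for F n
  proof -
    have "S F x - S {..<n} x = (\<Sum>j\<in>F - {..<n}. d j * e j x)" for x
      using that by (simp add: S_def sum_diff)
    then have "(l2_norm N (\<lambda>x. S F x - S {..<n} x))\<^sup>2 = sum a (F - {..<n})"
      using l2_norm_orthonormal_sum[OF e, of "F - {..<n}" d] that by (simp add: a_def)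
    also have "\<dots> \<le> tl n" using that by (intro tl_ge) auto
    finally show ?thesis .
  qed
  have "\<exists>m. \<forall>k. tl (m k) < 1 / 4 ^ k \<and> m k < m (Suc k)"
  proof (rule dependent_nat_choice)
    have *: "\<exists>y. tl y < 1 / 4 ^ k \<and> x < y" for k x
    proof -
      have "\<forall>\<^sub>F y in sequentially. tl y < 1 / 4 ^ k" by (intro order_tendstoD(2)[OF tl]) simp
      then have "\<forall>\<^sub>F y in sequentially. tl y < 1 / 4 ^ k \<and> x < y"
        using eventually_gt_at_top[of x] by eventually_elim auto
      then show ?thesis by (auto simp: eventually_sequentially)
    qed
    show "\<exists>x. tl x < 1 / 4 ^ 0" using *[of 0] by blast
    show "\<exists>y. tl y < 1 / 4 ^ Suc n \<and> x < y" for n x by (rule *)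
  qed
  then obtain m where m: "\<And>k. tl (m k) < 1 / 4 ^ k" and mono: "\<And>k. m k < m (Suc k)" by blast
  have smono: "strict_mono m" using mono by (simp add: strict_mono_Suc_iff)
  define T where "T k = S {..<m k}" for k
  have T: "T k \<in> l2 N" for k using S by (simp add: T_def)
  have inc: "(l2_norm N (\<lambda>x. T (Suc k) x - T k x))\<^sup>2 \<le> 1 / 4 ^ k" for k
    using S_diff[of "{..<m (Suc k)}" "m k"] mono[of k] m[of k] by (simp add: T_def)
  (* With increments of square norm at most 4^-k, the weighted sum of 2^k |T (k+1) - T k|^2 is
     integrable; so almost everywhere |T (k+1) - T k| decays geometrically. *)
  define D where "D k x = (cmod (T (Suc k) x - T k x))\<^sup>2" for k x
  have D_meas: "D k \<in> borel_measurable N" for k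
    unfolding D_def using l2_borel[OF T] by simp
  have D_int: "(\<integral>\<^sup>+x. ennreal (2 ^ k * D k x) \<partial>N) \<le> ennreal ((1/2) ^ k)" for k
  proof -
    have int: "integrable N (D k)"
      unfolding D_def using l2_diff[OF T T, of "Suc k" k] by (simp add: l2_def)
    have "(\<integral>\<^sup>+x. ennreal (2 ^ k * D k x) \<partial>N) = ennreal (\<integral>x. 2 ^ k * D k x \<partial>N)"
      using integrable_mult_right[of "2 ^ k", OF int] by (intro nn_integral_eq_integral) (simp_all add: D_def)
    also have "\<dots> \<le> ennreal ((1/2) ^ k)"
    proof (rule ennreal_leI)
      have "(\<integral>x. 2 ^ k * D k x \<partial>N) = 2 ^ k * (l2_norm N (\<lambda>x. T (Suc k) x - T k x))\<^sup>2"
        by (simp add: D_def l2_norm_square)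
      also have "\<dots> \<le> 2 ^ k * (1 / 4 ^ k)" using inc by (intro mult_left_mono) auto
      also have "\<dots> = (2 / 4) ^ k" by (simp only: power_divide) simp
      also have "\<dots> = (1/2) ^ k" by simp
      finally show "(\<integral>x. 2 ^ k * D k x \<partial>N) \<le> (1/2) ^ k" .
    qed
    finally show ?thesis .
  qed
  have "(\<integral>\<^sup>+x. (\<Sum>k. ennreal (2 ^ k * D k x)) \<partial>N) = (\<Sum>k. \<integral>\<^sup>+x. ennreal (2 ^ k * D k x) \<partial>N)"
    using D_meas by (intro nn_integral_suminf) simp
  also have "\<dots> \<le> (\<Sum>k. ennreal ((1/2) ^ k))"
    by (intro suminf_le D_int summableI)
  also have "\<dots> = ennreal (\<Sum>k. (1/2) ^ k)"
    by (rule suminf_ennreal2) (simp_all add: summable_geometric)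
  also have "\<dots> < \<infinity>" by (simp only: ennreal_less_top infinity_ennreal_def)
  finally have fin: "(\<integral>\<^sup>+x. (\<Sum>k. ennreal (2 ^ k * D k x)) \<partial>N) \<noteq> \<infinity>" by simp
  have "AE x in N. (\<Sum>k. ennreal (2 ^ k * D k x)) \<noteq> \<infinity>"
    using D_meas by (intro nn_integral_PInf_AE[OF _ fin]) simp
  then have conv: "AE x in N. convergent (\<lambda>k. T k x)"
  proof eventually_elim
    case (elim x)
    have "summable (\<lambda>k. 2 ^ k * D k x)"
      using elim by (intro summable_suminf_not_top) (auto simp: D_def)
    then obtain C where C: "\<And>k. 2 ^ k * D k x \<le> C" "C > 0"
      using summable_imp_Bseq by (force simp: Bseq_def D_def)
    have "summable (\<lambda>k. T (Suc k) x - T k x)"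
    proof (rule summable_comparison_test')
      show "summable (\<lambda>k. sqrt C * (sqrt (1/2)) ^ k)"
        by (intro summable_mult summable_geometric) (simp add: real_sqrt_divide)
      show "norm (T (Suc k) x - T k x) \<le> sqrt C * (sqrt (1/2)) ^ k" for k
      proof (rule power2_le_imp_le)
        have "D k x \<le> C * (1/2) ^ k" using C(1)[of k] by (simp add: field_simps)
        also have "\<dots> = (sqrt C)\<^sup>2 * ((sqrt (1/2))\<^sup>2) ^ k" using C(2) by simp
        also have "\<dots> = (sqrt C * (sqrt (1/2)) ^ k)\<^sup>2"
          by (simp only: power_mult_distrib power_mult[symmetric] mult.commute[of k 2])
        finally show "(norm (T (Suc k) x - T k x))\<^sup>2 \<le> (sqrt C * (sqrt (1/2)) ^ k)\<^sup>2" by (simp add: D_def)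
      qed (use C(2) in auto)
    qed
    then have "convergent (\<lambda>n. T n x - T 0 x)"
      by (simp add: summable_iff_convergent sum_lessThan_telescope[of "\<lambda>i. T i x"])
    then show ?case by (simp add: convergent_diff_const_right_iff)
  qed
  define s where "s x = lim (\<lambda>k. T k x)" for x
  have s_meas: "s \<in> borel_measurable N"
    unfolding s_def using l2_borel[OF T] by (intro borel_measurable_lim_metric)
  have lim: "AE x in N. (\<lambda>k. T k x) \<longlonglongrightarrow> s x"
    using conv by eventually_elim (simp add: s_def convergent_LIMSEQ_iff)
  have close: "s \<in> l2 N" "(l2_norm N (\<lambda>x. s x - S {..<n} x))\<^sup>2 \<le> tl n" for n
  proof -
    \<comment> \<open>A strictly increasing m satisfies \<open>k \<le> m k\<close>, so from k = n on
      the partial sum \<open>T k\<close> covers \<open>{..<n}\<close>.\<close>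
    have b: "(l2_norm N (\<lambda>x. T k x - S {..<n} x))\<^sup>2 \<le> tl n" if "k \<ge> n" for k
      unfolding T_def using that seq_suble[OF smono, of k] by (intro S_diff) auto
    show "s \<in> l2 N" "(l2_norm N (\<lambda>x. s x - S {..<n} x))\<^sup>2 \<le> tl n"
      using l2_norm_AE_limit_le[OF T S s_meas lim b] by auto
  qed
  have "((\<lambda>F. (l2_norm N (\<lambda>x. (\<Sum>j\<in>F. c j * e j x) - s x))\<^sup>2) \<longlongrightarrow> 0) (finite_subsets_at_top J)"
  proof (rule tendstoI)
    fix \<epsilon> :: real assume "\<epsilon> > 0"
    then have "\<forall>\<^sub>F n in sequentially. tl n < \<epsilon> / 4" by (intro order_tendstoD(2)[OF tl]) simp
    then obtain n where n: "tl n < \<epsilon> / 4" by (auto simp: eventually_sequentially)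
    show "\<forall>\<^sub>F F in finite_subsets_at_top J. dist ((l2_norm N (\<lambda>x. (\<Sum>j\<in>F. c j * e j x) - s x))\<^sup>2) 0 < \<epsilon>"
      unfolding eventually_finite_subsets_at_top
    proof (intro exI[of _ "J \<inter> {..<n}"] conjI allI impI)
      fix F assume F: "finite F \<and> J \<inter> {..<n} \<subseteq> F \<and> F \<subseteq> J"
      \<comment> \<open>Enlarging \<open>F\<close> by \<open>{..<n}\<close> adds only indices
        outside \<open>J\<close>, where d is 0; the enlarged set is one to which
        \<open>S_diff\<close> applies.\<close>
      have eq: "(\<Sum>j\<in>F. c j * e j x) = S (F \<union> {..<n}) x" for x
        unfolding S_def using F by (intro sum.mono_neutral_cong_left) (auto simp: d_def)
      have "(l2_norm N (\<lambda>x. S (F \<union> {..<n}) x - s x))\<^sup>2 \<le>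
          2 * (l2_norm N (\<lambda>x. S (F \<union> {..<n}) x - S {..<n} x))\<^sup>2 + 2 * (l2_norm N (\<lambda>x. S {..<n} x - s x))\<^sup>2"
        using l2_norm_add_square_le[OF l2_diff[OF S S] l2_diff[OF S close(1)], of "F \<union> {..<n}" "{..<n}" "{..<n}"] by simp
      also have "\<dots> \<le> 2 * tl n + 2 * tl n"
        using S_diff[of "F \<union> {..<n}" n] close(2)[of n] F l2_norm_minus_commute[of N s "S {..<n}"] by simp
      also have "\<dots> < \<epsilon>" using n by simp
      finally show "dist ((l2_norm N (\<lambda>x. (\<Sum>j\<in>F. c j * e j x) - s x))\<^sup>2) 0 < \<epsilon>"
        unfolding eq by (simp add: dist_real_def)
    qed auto
  qed
  then show ?thesis using close(1) by (auto simp: has_l2_sum_iff_square)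
qed

section \<open>Consequences of the Weyl law\<close>

text \<open>Needed before the Weyl law can be used quantitatively: it makes the index sets
  \<open>{j. E j \<le> t}\<close> finite and the sums over them genuine. By monotonicity it suffices
  that the eigenvalues are unbounded.\<close>

lemma weyl_filterlim_at_top:
  fixes E w :: "nat \<Rightarrow> real"
  assumes E: "strict_mono E"
    and weyl: "(\<lambda>t. (\<Sum>\<^sub>\<infinity>j\<in>{j. E j \<le> t}. w j) - t / (4 * pi)) \<in> O(\<lambda>t. sqrt t)"
  shows "filterlim E at_top sequentially"
proof -
  (* If the eigenvalues were bounded, the counting function would be eventually constant (it would be
     the junk value 0 if the weights were not summable). *)
  have unb: "\<exists>j. E j > L" for L
  proof (rule ccontr)
    assume "\<nexists>j. E j > L"
    then have U: "{j. E j \<le> t} = UNIV" if "t \<ge> L" for t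
      using that by (auto simp: not_less intro: order.trans)
    define W where "W = (\<Sum>\<^sub>\<infinity>j. w j)"
    obtain c where c: "\<forall>\<^sub>F t in at_top. norm ((\<Sum>\<^sub>\<infinity>j\<in>{j. E j \<le> t}. w j) - t / (4 * pi)) \<le> c * norm (sqrt t)"
      using landau_o.bigE[OF weyl] by blast
    have "filterlim (\<lambda>t. t / (4 * pi) - c * sqrt t) at_top at_top"
      by real_asymp
    then have "\<forall>\<^sub>F t in at_top. t / (4 * pi) - c * sqrt t > W"
      by (simp add: filterlim_at_top_dense)
    then have "\<forall>\<^sub>F t in at_top. W < t / (4 * pi) - c * sqrt t \<and>
        norm ((\<Sum>\<^sub>\<infinity>j\<in>{j. E j \<le> t}. w j) - t / (4 * pi)) \<le> c * norm (sqrt t) \<and> t \<ge> L \<and> t \<ge> 0"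
      using c eventually_ge_at_top[of L] eventually_ge_at_top[of 0] by eventually_elim auto
    then obtain t where t: "W < t / (4 * pi) - c * sqrt t"
        "norm ((\<Sum>\<^sub>\<infinity>j\<in>{j. E j \<le> t}. w j) - t / (4 * pi)) \<le> c * norm (sqrt t)" "t \<ge> L" "t \<ge> 0"
      using eventually_happens' trivial_limit_at_top_linorder by blast
    then show False using U[of t] by (simp add: W_def)
  qed
  show ?thesis
    unfolding filterlim_at_top
  proof
    fix Z
    obtain j where "E j > Z" using unb by blast
    then show "\<forall>\<^sub>F n in sequentially. Z \<le> E n"
      unfolding eventually_sequentially using strict_mono_mono[OF E] by (meson less_imp_le monoD order.trans)
  qed
qed

lemma finite_eigenvalues_le:
  fixes E :: "nat \<Rightarrow> real"
  assumes "filterlim E at_top sequentially"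
  shows "finite {j. E j \<le> t}"
proof -
  have "\<forall>\<^sub>F j in cofinite. t < E j"
    using assms by (simp add: filterlim_at_top_dense cofinite_eq_sequentially)
  then show ?thesis by (simp add: eventually_cofinite not_less)
qed

lemma weyl_summable:
  fixes E w :: "nat \<Rightarrow> real"
  assumes E: "strict_mono E" and w: "\<And>j. w j \<ge> 0"
    and weyl: "(\<lambda>t. (\<Sum>\<^sub>\<infinity>j\<in>{j. E j \<le> t}. w j) - t / (4 * pi)) \<in> O(\<lambda>t. sqrt t)"
  shows "summable (\<lambda>j. w j / (1 + (E j)\<^sup>2))"
proof -
  define A where "A t = (\<Sum>j | E j \<le> t. w j)" for t
  have fin: "finite {j. E j \<le> t}" for t
    by (rule finite_eigenvalues_le[OF weyl_filterlim_at_top[OF E weyl]])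
  have A_mono: "A s \<le> A t" if "s \<le> t" for s t
    unfolding A_def using that w fin by (intro sum_mono2) auto
  have "(\<lambda>t. A t - t / (4 * pi)) \<in> O(\<lambda>t. sqrt t)"
    using weyl fin by (simp add: A_def)
  also have "(\<lambda>t. sqrt t) \<in> O(\<lambda>t::real. t)" by real_asymp
  finally have "(\<lambda>t. (A t - t / (4 * pi)) + t / (4 * pi)) \<in> O(\<lambda>t. t)"
    by (rule sum_in_bigo) simp
  then obtain c where c: "\<forall>\<^sub>F t in at_top. norm (A t) \<le> c * norm t"
    by (simp only: diff_add_cancel) (elim landau_o.bigE, blast)
  then obtain T where T: "\<And>t. t \<ge> T \<Longrightarrow> norm (A t) \<le> c * norm t"
    unfolding eventually_at_top_linorder by blast
  \<comment> \<open>Stretching \<open>2 ^ k\<close> by the factor \<open>max 1 T\<close> reaches the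
    range where the growth bound holds, for every k. By monotonicity of A this only enlarges the
    constant.\<close>
  define C where "C = \<bar>c\<bar> * max 1 T"
  have C0: "C \<ge> 0" by (simp add: C_def)
  have A_le: "A (2 ^ k) \<le> C * 2 ^ k" for k
  proof -
    have k1: "(1::real) \<le> 2 ^ k" by simp
    let ?t = "max 1 T * 2 ^ k"
    have t: "T \<le> ?t" "2 ^ k \<le> ?t" "?t \<ge> 0"
      using k1 mult_mono[of "max 1 T" "max 1 T" 1 "2 ^ k"] mult_mono[of 1 "max 1 T" "2^k" "2 ^ k"] by auto
    have "A (2 ^ k) \<le> A ?t" by (rule A_mono[OF t(2)])
    also have "\<dots> \<le> c * ?t" using T[OF t(1)] t(3) by simp
    also have "\<dots> \<le> \<bar>c\<bar> * ?t" using t(3) by (intro mult_right_mono) auto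
    finally show ?thesis by (simp add: C_def mult.assoc)
  qed
  (* Dyadic decomposition of the spectrum: the eigenvalues with r j = k have total weight O(2^k)
     by the Weyl law and contribute at most 4 * 4^-k times that weight. *)
  define r where "r j = (LEAST k. E j \<le> 2 ^ k)" for j
  have ex: "\<exists>k. E j \<le> 2 ^ k" for j
    using real_arch_pow[of 2 "E j"] by (force intro: less_imp_le)
  have r1: "E j \<le> 2 ^ r j" for j unfolding r_def using ex by (rule LeastI_ex)
  have r2: "1 / (1 + (E j)\<^sup>2) \<le> 4 * (1/4) ^ r j" for j
  proof (cases "r j")
    case 0
    have "1 / (1 + (E j)\<^sup>2) \<le> 1" by (simp add: add_pos_nonneg)
    then show ?thesis using 0 by simp
  next
    case (Suc k)
    have "E j > 2 ^ k" using not_less_Least[of k "\<lambda>k. E j \<le> 2 ^ k"] Suc by (simp add: r_def not_le)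
    then have "(2 ^ k)\<^sup>2 \<le> (E j)\<^sup>2" by (intro power_mono) auto
    moreover have "(2 ^ k)\<^sup>2 = (4::real) ^ k" by (simp add: power2_eq_square flip: power_mult_distrib)
    ultimately have "4 ^ k \<le> 1 + (E j)\<^sup>2" by linarith
    then have "1 / (1 + (E j)\<^sup>2) \<le> 1 / 4 ^ k" by (intro divide_left_mono) (auto simp: add_pos_nonneg)
    then show ?thesis using Suc by (simp add: power_one_over)
  qed
  show ?thesis
  proof (rule summableI_nonneg_bounded)
    show "0 \<le> w j / (1 + (E j)\<^sup>2)" for j using w by (simp add: add_nonneg_nonneg)
    fix n
    define K where "K = Max (r ` {..n})"
    have K: "r j \<le> K" if "j < n" for j unfolding K_def using that by (intro Max_ge) auto
    have "(\<Sum>j<n. w j / (1 + (E j)\<^sup>2)) \<le> (\<Sum>j<n. 4 * (1/4) ^ r j * w j)"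
      using mult_right_mono[OF r2 w] by (intro sum_mono) simp
    also have "\<dots> = (\<Sum>k\<le>K. \<Sum>j | j \<in> {..<n} \<and> r j = k. 4 * (1/4) ^ r j * w j)"
      using K by (intro sum.group[symmetric]) auto
    also have "\<dots> \<le> (\<Sum>k\<le>K. 4 * (1/4) ^ k * A (2 ^ k))"
    proof (rule sum_mono)
      fix k
      have "(\<Sum>j | j \<in> {..<n} \<and> r j = k. 4 * (1/4) ^ r j * w j) = 4 * (1/4) ^ k * (\<Sum>j | j \<in> {..<n} \<and> r j = k. w j)"
        by (simp add: sum_distrib_left)
      also have "\<dots> \<le> 4 * (1/4) ^ k * A (2 ^ k)"
        unfolding A_def using r1 w fin by (intro mult_left_mono sum_mono2) auto
      finally show "(\<Sum>j | j \<in> {..<n} \<and> r j = k. 4 * (1/4) ^ r j * w j) \<le> 4 * (1/4) ^ k * A (2 ^ k)" .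
    qed
    also have "\<dots> \<le> (\<Sum>k\<le>K. 4 * C * (1/2) ^ k)"
    proof (rule sum_mono)
      fix k
      have "4 * (1/4) ^ k * A (2 ^ k) \<le> 4 * (1/4) ^ k * (C * 2 ^ k)" using A_le by (intro mult_left_mono) auto
      also have "\<dots> = 4 * C * ((1/4) * 2) ^ k" by (simp only: power_mult_distrib) simp
      finally show "4 * (1/4) ^ k * A (2 ^ k) \<le> 4 * C * (1/2) ^ k" by simp
    qed
    also have "\<dots> = 4 * C * (\<Sum>k\<le>K. (1/2) ^ k)" by (simp add: sum_distrib_left)
    also have "\<dots> \<le> 4 * C * (\<Sum>k. (1/2) ^ k)"
      using C0 by (intro mult_left_mono sum_le_suminf summable_geometric) auto
    finally show "(\<Sum>j<n. w j / (1 + (E j)\<^sup>2)) \<le> 4 * C * (\<Sum>k. (1/2) ^ k)" .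
  qed
qed

section \<open>The quasimodes of the point scatterer\<close>

lemma has_sum_split_finite:
  fixes f :: "'a \<Rightarrow> real"
  assumes "(f has_sum s) UNIV" "finite K"
  shows "s = sum f K + infsum f (- K)"
proof -
  have f: "f summable_on UNIV" using assms(1) by (rule has_sum_imp_summable)
  then have g: "f summable_on (- K)" by (rule summable_on_subset_banach) simp
  have "s = infsum f (K \<union> - K)" using assms(1) by (simp add: infsumI)
  also have "\<dots> = infsum f K + infsum f (- K)"
    using assms(2) g by (intro infsum_Un_disjoint) auto
  finally show ?thesis using assms(2) by simp
qed

text \<open>Writes a finite combination as a series over all indices, so that it can be added
  termwise to the series of g_i and g_-i.\<close>

lemma has_l2_sum_finite_support:
  assumes "l2_orthonormal N e" "finite K"
  shows "has_l2_sum N (\<lambda>j x. (if j \<in> K then c j else 0) * e j x) UNIV (\<lambda>x. \<Sum>j\<in>K. c j * e j x)"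
proof -
  let ?c = "\<lambda>j. if j \<in> K then c j else 0"
  have z: "has_l2_sum N (\<lambda>j x. ?c j * e j x) (- K) (\<lambda>x. 0)"
    by (rule has_l2_sum_cong[OF has_l2_sum_zero]) simp
  have "has_l2_sum N (\<lambda>j x. ?c j * e j x) (K \<union> - K) (\<lambda>x. (\<Sum>j\<in>K. ?c j * e j x) + 0)"
    by (rule has_l2_sum_finite_Un[OF z assms(2)]) (simp_all only: l2_cmult l2_orthonormal_l2[OF assms(1)] Compl_disjoint)
  then show ?thesis by simp
qed

lemma norm_of_real_1_plus_square: "cmod (of_real (1 + x\<^sup>2)) = 1 + x\<^sup>2" for x :: real
  by (simp only: norm_of_real abs_of_pos add_pos_nonneg zero_less_one zero_le_power2)

(* Determines the coefficients a of g_i and b = - exp (i Theta) a of g_-i for which a g_i + b g_-i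
   has the same coefficients as psi outside I. *)
lemma scattering_phase:
  assumes \<Theta>: "\<Theta> \<in> {0<..<2 * pi}" and \<kappa>: "\<kappa> = sin \<Theta> / (1 - cos \<Theta>)"
  obtains a where
    "a - exp (\<i> * of_real \<Theta>) * a = of_real \<sigma>"
    "\<i> * (a + exp (\<i> * of_real \<Theta>) * a) = - of_real (\<kappa> * \<sigma>)"
proof -
  define z where "z = exp (\<i> * of_real \<Theta>)"
  have "sin (\<Theta> / 2) > 0" using \<Theta> by (intro sin_gt_zero) auto
  then have "cos \<Theta> \<noteq> 1" using cos_double_sin[of "\<Theta> / 2"] by simp
  then have c: "1 - cos \<Theta> \<noteq> 0" by simp
  have z: "z = Complex (cos \<Theta>) (sin \<Theta>)" by (simp add: z_def exp_eq_polar cis.code)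
  have k1: "\<kappa> * (1 - cos \<Theta>) = sin \<Theta>" using c \<kappa> by simp
  have "\<kappa> * sin \<Theta> = (sin \<Theta> * sin \<Theta>) / (1 - cos \<Theta>)" using \<kappa> by simp
  also have "sin \<Theta> * sin \<Theta> = (1 + cos \<Theta>) * (1 - cos \<Theta>)"
    using sin_squared_eq[of \<Theta>] by (simp add: power2_eq_square algebra_simps)
  finally have k2: "\<kappa> * sin \<Theta> = 1 + cos \<Theta>" using c by simp
  have z1: "1 - z \<noteq> 0" using c by (auto simp: z complex_eq_iff)
  \<comment> \<open>The formula for kappa as cot(\<Theta>/2) with denominators cleared; its real and
    imaginary parts are \<open>k1\<close> and \<open>k2\<close>.\<close>
  have *: "\<i> * (1 + z) = - of_real \<kappa> * (1 - z)" using k1 k2 by (simp add: z complex_eq_iff)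
  define a where "a = of_real \<sigma> / (1 - z)"
  have 1: "(1 - z) * a = of_real \<sigma>" using z1 by (simp add: a_def)
  have "\<i> * (1 + z) * a = - of_real \<kappa> * ((1 - z) * a)" by (simp only: * mult.assoc)
  then have 2: "\<i> * (1 + z) * a = - of_real (\<kappa> * \<sigma>)" by (simp only: 1) simp
  show ?thesis
    by (rule that[of a]) (use 1 2 in \<open>simp_all add: z_def algebra_simps\<close>)
qed

section \<open>Spectral data and convergent series of the scatterer\<close>

context point_scatterer
begin

lemma Phi_orthonormal: "l2_orthonormal vol \<Phi>"
proof -
  have B: "\<Phi> j \<in> B" for j using Phi_enum by (auto simp: bij_betw_def)
  have "inj \<Phi>" using Phi_enum by (simp add: bij_betw_def)
  then show ?thesis
    using basis B by (auto simp: l2_orthonormal_def l2_orthonormal_basis_def inj_eq subset_iff)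
qed

lemmas Phi_l2 = l2_orthonormal_l2[OF Phi_orthonormal]

lemma Phi_continuous: "continuous (at p within M) (\<Phi> j)"
  using Phi_enum by (intro basis_continuous) (auto simp: bij_betw_def)

lemma Phi_nonzero: "\<Phi> j p \<noteq> 0"
  using Phi_enum by (auto simp: bij_betw_def)

lemma summable_weights: "summable (\<lambda>j. (cmod (\<Phi> j p))\<^sup>2 / (1 + (E j)\<^sup>2))"
  by (rule weyl_summable[OF E_strict _ weyl]) simp

lemma finite_bounded_eigenvalues:
  assumes "bounded I"
  shows "finite {j. E j \<in> I}"
proof -
  obtain b where b: "\<forall>x\<in>I. \<bar>x\<bar> \<le> b" using assms by (auto simp: bounded_real)
  show ?thesis
    by (rule finite_subset[OF _ finite_eigenvalues_le[OF weyl_filterlim_at_top[OF E_strict weyl], of b]])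
      (use b in force)
qed

text \<open>With v = 1 this covers both the tail of \<open>psi\<close> (u = -\<kappa>) and g_i, g_-i
  (u = i, -i). By Cauchy-Schwarz in the plane |u + v E|^2 is at most Q (1 + E^2), which cancels one
  of the two factors 1 + E^2 and leaves the summable weights.\<close>

lemma has_l2_sum_linear_weight:
  fixes u v :: complex
  shows "\<exists>s. has_l2_sum vol
    (\<lambda>j x. (u + v * of_real (E j)) * (cnj (\<Phi> j p) / of_real (1 + (E j)\<^sup>2)) * \<Phi> j x) J s"
proof (rule Riesz_Fischer[OF Phi_orthonormal])
  let ?c = "\<lambda>j. (u + v * of_real (E j)) * (cnj (\<Phi> j p) / of_real (1 + (E j)\<^sup>2))"
  define Q where "Q = (cmod u)\<^sup>2 + (cmod v)\<^sup>2"
  have "summable (\<lambda>j. norm ((cmod (?c j))\<^sup>2))"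
  proof (rule summable_comparison_test'[OF summable_mult[OF summable_weights, of Q]])
    fix j
    have pos: "1 + (E j)\<^sup>2 > 0" by (simp add: add_pos_nonneg)
    have "cmod (u + v * of_real (E j)) \<le> cmod u + cmod v * \<bar>E j\<bar>"
      using norm_triangle_ineq[of u "v * of_real (E j)"] by (simp add: norm_mult)
    then have "(cmod (u + v * of_real (E j)))\<^sup>2 \<le> (cmod u + cmod v * \<bar>E j\<bar>)\<^sup>2"
      by (intro power_mono) auto
    also have "\<dots> \<le> Q * (1 + (E j)\<^sup>2)"
    proof -
      have "Q * (1 + (E j)\<^sup>2) - (cmod u + cmod v * \<bar>E j\<bar>)\<^sup>2 = (cmod u * \<bar>E j\<bar> - cmod v)\<^sup>2"
        by (simp add: Q_def power2_eq_square algebra_simps)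
      then show ?thesis using zero_le_power2[of "cmod u * \<bar>E j\<bar> - cmod v"] by linarith
    qed
    finally have "(cmod (u + v * of_real (E j)))\<^sup>2 * ((cmod (\<Phi> j p))\<^sup>2 / (1 + (E j)\<^sup>2)\<^sup>2) \<le>
        (Q * (1 + (E j)\<^sup>2)) * ((cmod (\<Phi> j p))\<^sup>2 / (1 + (E j)\<^sup>2)\<^sup>2)"
      by (intro mult_right_mono) auto
    moreover have "(cmod (?c j))\<^sup>2 = (cmod (u + v * of_real (E j)))\<^sup>2 * ((cmod (\<Phi> j p))\<^sup>2 / (1 + (E j)\<^sup>2)\<^sup>2)"
      using pos by (simp only: norm_mult norm_divide power_mult_distrib power_divide complex_mod_cnj norm_of_real power2_abs)
    moreover have "(Q * (1 + (E j)\<^sup>2)) * ((cmod (\<Phi> j p))\<^sup>2 / (1 + (E j)\<^sup>2)\<^sup>2) = Q * ((cmod (\<Phi> j p))\<^sup>2 / (1 + (E j)\<^sup>2))"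
      using pos by (simp add: power2_eq_square[of "1 + (E j)\<^sup>2"])
    ultimately show "norm (norm ((cmod (?c j))\<^sup>2)) \<le> Q * ((cmod (\<Phi> j p))\<^sup>2 / (1 + (E j)\<^sup>2))"
      by simp
  qed
  then have "(\<lambda>j. (cmod (?c j))\<^sup>2) summable_on UNIV" by (rule norm_summable_imp_summable_on)
  then show "(\<lambda>j. (cmod (?c j))\<^sup>2) summable_on J" by (rule summable_on_subset_banach) simp
qed

lemma complex_resolvent_weight:
  "1 / (complex_of_real (E j) - \<i>) = (\<i> + of_real (E j)) / of_real (1 + (E j)\<^sup>2)"
  "1 / (complex_of_real (E j) + \<i>) = (- \<i> + of_real (E j)) / of_real (1 + (E j)\<^sup>2)"
proof -
  have "complex_of_real (E j) - \<i> \<noteq> 0" "complex_of_real (E j) + \<i> \<noteq> 0" by (auto simp: complex_eq_iff)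
  moreover have "complex_of_real (1 + (E j)\<^sup>2) = (of_real (E j) - \<i>) * (of_real (E j) + \<i>)"
    by (simp add: algebra_simps power2_eq_square)
  ultimately show
    "1 / (complex_of_real (E j) - \<i>) = (\<i> + of_real (E j)) / of_real (1 + (E j)\<^sup>2)"
    "1 / (complex_of_real (E j) + \<i>) = (- \<i> + of_real (E j)) / of_real (1 + (E j)\<^sup>2)"
    by (simp_all add: add.commute)
qed

lemma has_l2_sum_greens:
  assumes "z = \<i> \<or> z = - \<i>"
  shows "has_l2_sum vol (\<lambda>j x. cnj (\<Phi> j p) / (of_real (E j) - z) * \<Phi> j x) UNIV (greens vol p \<Phi> E z)"
proof -
  obtain s where s: "has_l2_sum vol
      (\<lambda>j x. (z + 1 * of_real (E j)) * (cnj (\<Phi> j p) / of_real (1 + (E j)\<^sup>2)) * \<Phi> j x) UNIV s"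
    using has_l2_sum_linear_weight by blast
  have "has_l2_sum vol (\<lambda>j x. cnj (\<Phi> j p) / (of_real (E j) - z) * \<Phi> j x) UNIV s"
  proof (rule has_l2_sum_cong[OF s])
    fix j x
    have "1 / (of_real (E j) - z) = (z + of_real (E j)) / of_real (1 + (E j)\<^sup>2)"
      using assms complex_resolvent_weight[of j] by auto
    then have "cnj (\<Phi> j p) * (1 / (of_real (E j) - z)) = cnj (\<Phi> j p) * ((z + of_real (E j)) / of_real (1 + (E j)\<^sup>2))"
      by simp
    then show "(z + 1 * of_real (E j)) * (cnj (\<Phi> j p) / of_real (1 + (E j)\<^sup>2)) * \<Phi> j x =
        cnj (\<Phi> j p) / (of_real (E j) - z) * \<Phi> j x"
      by (simp add: mult.commute)
  qed
  then show ?thesis unfolding greens_def by (rule has_l2_sum_l2_infsum)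
qed

text \<open>The function lies in its own span, which is a deficiency space by assumption; hence the
  adjoint of \<open>H0\<close> acts on it as multiplication by z.\<close>

lemma greens_adjoint:
  assumes "z = \<i> \<or> z = - \<i>"
  shows "(greens vol p \<Phi> E z, \<lambda>x. z * greens vol p \<Phi> E z x) \<in> l2_adjoint vol (H0 M vol Lap p)"
proof -
  have "greens vol p \<Phi> E z \<in> l2_span1 vol (greens vol p \<Phi> E z)"
    using has_l2_sum_l2[OF has_l2_sum_greens[OF assms]] by (auto simp: l2_span1_def intro!: exI[of _ 1])
  then have "greens vol p \<Phi> E z \<in> l2_deficiency vol (H0 M vol Lap p) z"
    using assms deficiency_plus deficiency_minus by auto
  then show ?thesis by (simp add: l2_deficiency_def)
qed

section \<open>The Laplacian, its restriction and membership in H_Theta\<close>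

lemma Lap_adjoint: "l2_adjoint vol Lap = Lap"
  using Lap by (simp add: self_adjoint_laplacian_def l2_self_adjoint_def)

lemma Lap_l2: "Lap \<subseteq> l2 vol \<times> l2 vol"
  using Lap_adjoint by (auto simp: l2_adjoint_def)

lemma H0_l2: "H0 M vol Lap p \<subseteq> l2 vol \<times> l2 vol"
  using Lap_l2 l2_cmult[of _ vol "-1"] by (auto simp: H0_def)

lemma H0_symmetric:
  assumes "(f, g) \<in> H0 M vol Lap p"
  shows "(f, g) \<in> l2_adjoint vol (H0 M vol Lap p)"
proof -
  have neg: "l2_inner vol (\<lambda>x. - v x) k = - l2_inner vol v k" "l2_inner vol k (\<lambda>x. - v x) = - l2_inner vol k v" for v k
    using l2_inner_cmult_left[of vol "-1" v k] l2_inner_cmult_right[of vol k "-1" v] by simp_all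
  obtain g' where g': "(f, g') \<in> Lap" "g = (\<lambda>x. - g' x)" using assms by (auto simp: H0_def)
  then have adj: "(f, g') \<in> l2_adjoint vol Lap" by (simp add: Lap_adjoint)
  have "l2_inner vol v f = l2_inner vol u g" if "(u, v) \<in> H0 M vol Lap p" for u v
  proof -
    obtain v' where v': "(u, v') \<in> Lap" "v = (\<lambda>x. - v' x)" using \<open>(u, v) \<in> _\<close> by (auto simp: H0_def)
    then have "l2_inner vol v' f = l2_inner vol u g'" using adj by (auto simp: l2_adjoint_def)
    then show ?thesis by (simp add: v'(2) g'(2) neg)
  qed
  then show ?thesis using subsetD[OF H0_l2 assms] by (auto simp: l2_adjoint_def)
qed

lemma finite_sum_H0:
  assumes "finite K" "(\<Sum>j\<in>K. c j * \<Phi> j p) = 0"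
  shows "(\<lambda>x. \<Sum>j\<in>K. c j * \<Phi> j x, \<lambda>x. \<Sum>j\<in>K. of_real (E j) * c j * \<Phi> j x) \<in> H0 M vol Lap p"
proof -
  let ?f = "\<lambda>x. \<Sum>j\<in>K. c j * \<Phi> j x" and ?g = "\<lambda>x. \<Sum>j\<in>K. c j * (- (of_real (E j) * \<Phi> j x))"
  \<comment> \<open>Linearity of \<open>Lap\<close> is obtained from self-adjointness: adjoint
    graphs are closed under linear combinations.\<close>
  have "(?f, ?g) \<in> l2_adjoint vol Lap"
    by (intro l2_adjoint_sum l2_adjoint_cmult Lap_l2 assms(1)) (simp add: Lap_adjoint Phi_eigen)
  then have "(?f, ?g) \<in> Lap" by (simp only: Lap_adjoint)
  moreover have "vanishes_at M vol p ?f"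
    unfolding vanishes_at_def using assms(2) Phi_continuous
    by (intro exI[of _ ?f]) (auto intro!: continuous_intros)
  ultimately have "(?f, \<lambda>x. - ?g x) \<in> H0 M vol Lap p"
    unfolding H0_def mem_Collect_eq by (intro exI[of _ ?f] exI[of _ ?g] conjI refl)
  moreover have "(\<lambda>x. \<Sum>j\<in>K. of_real (E j) * c j * \<Phi> j x) = (\<lambda>x. - ?g x)"
    by (simp add: sum_negf mult_ac)
  ultimately show ?thesis by (simp only:)
qed

text \<open>The second component is the action of the adjoint of \<open>H0\<close>: multiplication
  by \<open>E j\<close> on each eigenfunction of the D_p component, by i on g_i and by -i on
  g_-i.\<close>

lemma H_Theta_memI:
  assumes K: "finite K" "(\<Sum>j\<in>K. c j * \<Phi> j p) = 0"
    and b: "b = - exp (\<i> * of_real \<Theta>) * a"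
    and \<psi>: "\<psi> \<in> l2 vol"
    and eq: "AE x in vol. \<psi> x = (\<Sum>j\<in>K. c j * \<Phi> j x) + a * greens vol p \<Phi> E \<i> x + b * greens vol p \<Phi> E (- \<i>) x"
  shows "(\<psi>, \<lambda>x. (\<Sum>j\<in>K. of_real (E j) * c j * \<Phi> j x) + a * (\<i> * greens vol p \<Phi> E \<i> x) +
    b * (- \<i> * greens vol p \<Phi> E (- \<i>) x)) \<in> H_Theta M vol Lap p \<Phi> E \<Theta>" (is "(_, ?h) \<in> _")
proof -
  let ?f = "\<lambda>x. \<Sum>j\<in>K. c j * \<Phi> j x"
  note f = finite_sum_H0[OF K]
  have "(\<lambda>x. ?f x + a * greens vol p \<Phi> E \<i> x + b * greens vol p \<Phi> E (- \<i>) x, ?h) \<in> l2_adjoint vol (H0 M vol Lap p)"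
    by (intro l2_adjoint_add H0_symmetric f H0_l2 l2_adjoint_cmult greens_adjoint) auto
  then have "(\<psi>, ?h) \<in> l2_adjoint vol (H0 M vol Lap p)"
    by (rule l2_adjoint_cong) (use \<psi> eq H0_l2 in auto)
  moreover have "deficiency_decomposition M vol Lap p \<Phi> E \<psi> ?f a b"
    using f eq by (auto simp: deficiency_decomposition_def)
  ultimately show ?thesis using b by (auto simp: H_Theta_def)
qed

text \<open>A single series over all indices exhibits every coefficient of \<open>psi\<close>, as
  needed for Parseval's identity and for comparison with other series.\<close>

lemma
  assumes "bounded I"
  shows has_l2_sum_psi: "has_l2_sum vol (\<lambda>j x. (if E j \<in> I then cnj (\<Phi> j p) / of_real (E j - \<mu>)
      else of_real \<sigma> * (of_real (E j - \<kappa>) * (cnj (\<Phi> j p) / of_real (1 + (E j)\<^sup>2)))) * \<Phi> j x) UNIV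
    (psi vol p \<Phi> E \<kappa> \<sigma> I \<mu>)" (is "has_l2_sum vol (\<lambda>j x. ?c j * \<Phi> j x) UNIV _")
    and has_l2_sum_psi_tail: "has_l2_sum vol (\<lambda>j x. of_real (E j - \<kappa>) * (cnj (\<Phi> j p) / of_real (1 + (E j)\<^sup>2)) * \<Phi> j x) {j. E j \<notin> I}
    (l2_infsum vol (\<lambda>j x. of_real (E j - \<kappa>) * (cnj (\<Phi> j p) / of_real (1 + (E j)\<^sup>2)) * \<Phi> j x) {j. E j \<notin> I})"
proof -
  let ?d = "\<lambda>j x. of_real (E j - \<kappa>) * (cnj (\<Phi> j p) / of_real (1 + (E j)\<^sup>2)) * \<Phi> j x"
  have "\<exists>s. has_l2_sum vol ?d {j. E j \<notin> I} s"
    using has_l2_sum_linear_weight[of "- of_real \<kappa>" 1 "{j. E j \<notin> I}"] by (simp add: algebra_simps)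
  then show s: "has_l2_sum vol ?d {j. E j \<notin> I} (l2_infsum vol ?d {j. E j \<notin> I})"
    using has_l2_sum_l2_infsum by blast
  have s': "has_l2_sum vol (\<lambda>j x. ?c j * \<Phi> j x) {j. E j \<notin> I} (\<lambda>x. of_real \<sigma> * l2_infsum vol ?d {j. E j \<notin> I} x)"
    by (rule has_l2_sum_cong[OF has_l2_sum_cmult[OF s]]) (simp add: mult.assoc)
  have "has_l2_sum vol (\<lambda>j x. ?c j * \<Phi> j x) ({j. E j \<in> I} \<union> {j. E j \<notin> I})
      (\<lambda>x. (\<Sum>j | E j \<in> I. ?c j * \<Phi> j x) + of_real \<sigma> * l2_infsum vol ?d {j. E j \<notin> I} x)"
    by (rule has_l2_sum_finite_Un[OF s' finite_bounded_eigenvalues[OF assms]]) (auto simp only: intro!: l2_cmult Phi_l2)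
  moreover have "{j. E j \<in> I} \<union> {j. E j \<notin> I} = UNIV" by auto
  moreover have "(\<lambda>x. (\<Sum>j | E j \<in> I. ?c j * \<Phi> j x) + of_real \<sigma> * l2_infsum vol ?d {j. E j \<notin> I} x) = psi vol p \<Phi> E \<kappa> \<sigma> I \<mu>"
    by (auto simp: psi_def fun_eq_iff intro!: sum.cong)
  ultimately show "has_l2_sum vol (\<lambda>j x. ?c j * \<Phi> j x) UNIV (psi vol p \<Phi> E \<kappa> \<sigma> I \<mu>)" by simp
qed

text \<open>Over the common denominator 1 + E^2 the numerators of g_i and g_-i are E_j + i and E_j -
  i. The lemma is applied twice: with u = a, v = b to decompose \<open>psi\<close>, and with u = i
  a, v = -i b to find its image.\<close>

lemma has_l2_sum_greens_combination:
  "has_l2_sum vol (\<lambda>j x. ((u + v) * of_real (E j) + \<i> * (u - v)) * (cnj (\<Phi> j p) / of_real (1 + (E j)\<^sup>2)) * \<Phi> j x) UNIV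
    (\<lambda>x. u * greens vol p \<Phi> E \<i> x + v * greens vol p \<Phi> E (- \<i>) x)"
proof (rule has_l2_sum_cong[OF has_l2_sum_add[OF has_l2_sum_cmult[OF has_l2_sum_greens[of "\<i>"]] has_l2_sum_cmult[OF has_l2_sum_greens[of "- \<i>"]]]])
  fix j x
  let ?g = "cnj (\<Phi> j p)"
  have *: "?g / (of_real (E j) - \<i>) = ?g * ((\<i> + of_real (E j)) / of_real (1 + (E j)\<^sup>2))"
    "?g / (of_real (E j) - - \<i>) = ?g * ((- \<i> + of_real (E j)) / of_real (1 + (E j)\<^sup>2))"
    unfolding complex_resolvent_weight[symmetric] by simp_all
  show "u * (?g / (of_real (E j) - \<i>) * \<Phi> j x) + v * (?g / (of_real (E j) - - \<i>) * \<Phi> j x) =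
      ((u + v) * of_real (E j) + \<i> * (u - v)) * (?g / of_real (1 + (E j)\<^sup>2)) * \<Phi> j x"
    unfolding * by (simp add: divide_inverse algebra_simps)
qed (simp_all only: l2_cmult Phi_l2 simp_thms)

section \<open>Norms, residuals and inner products of the quasimodes\<close>

lemma zeta_finite:
  assumes "bounded I"
  shows "zeta p \<Phi> E I s \<mu> = (\<Sum>j | E j \<in> I. (cmod (\<Phi> j p))\<^sup>2 / (E j - \<mu>) ^ s)"
  using finite_bounded_eigenvalues[OF assms] by (simp add: zeta_def)

text \<open>This is the denominator of the squared discrepancy. It is positive because some
  \<open>E j\<close> lies in \<open>I\<close>, and its eigenfunction does not vanish at p.\<close>

lemma l2_norm_psi:
  assumes I: "bounded I" "\<exists>j. E j \<in> I" and \<mu>: "\<mu> \<notin> {E j | j. E j \<in> I}"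
  shows "(l2_norm vol (psi vol p \<Phi> E \<kappa> \<sigma> I \<mu>))\<^sup>2 = zeta p \<Phi> E I 2 \<mu> +
      \<sigma>\<^sup>2 * (\<Sum>\<^sub>\<infinity>j\<in>{j. E j \<notin> I}. (E j - \<kappa>)\<^sup>2 * ((cmod (\<Phi> j p))\<^sup>2 / (1 + (E j)\<^sup>2)\<^sup>2))"
    and "l2_norm vol (psi vol p \<Phi> E \<kappa> \<sigma> I \<mu>) > 0"
proof -
  let ?K = "{j. E j \<in> I}"
  note K = finite_bounded_eigenvalues[OF I(1)]
  note sum = has_sum_split_finite[OF has_l2_sum_Parseval[OF Phi_orthonormal
      has_l2_sum_psi[OF I(1), where \<mu>=\<mu> and \<sigma>=\<sigma> and \<kappa>=\<kappa>]] K]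
  have compl: "- ?K = {j. E j \<notin> I}" by auto
  have 1: "(\<Sum>j\<in>?K. (cmod (if E j \<in> I then cnj (\<Phi> j p) / of_real (E j - \<mu>)
      else of_real \<sigma> * (of_real (E j - \<kappa>) * (cnj (\<Phi> j p) / of_real (1 + (E j)\<^sup>2)))))\<^sup>2) = zeta p \<Phi> E I 2 \<mu>"
    unfolding zeta_finite[OF I(1)]
    by (rule sum.cong) (simp_all only: mem_Collect_eq if_True norm_divide norm_of_real power_divide power2_abs complex_mod_cnj)
  have 2: "(\<Sum>\<^sub>\<infinity>j\<in>{j. E j \<notin> I}. (cmod (if E j \<in> I then cnj (\<Phi> j p) / of_real (E j - \<mu>)
      else of_real \<sigma> * (of_real (E j - \<kappa>) * (cnj (\<Phi> j p) / of_real (1 + (E j)\<^sup>2)))))\<^sup>2) =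
      \<sigma>\<^sup>2 * (\<Sum>\<^sub>\<infinity>j\<in>{j. E j \<notin> I}. (E j - \<kappa>)\<^sup>2 * ((cmod (\<Phi> j p))\<^sup>2 / (1 + (E j)\<^sup>2)\<^sup>2))"
    unfolding infsum_cmult_right'[symmetric]
    by (rule infsum_cong) (simp_all only: mem_Collect_eq if_False norm_divide norm_mult norm_of_real power_divide
      power_mult_distrib power2_abs complex_mod_cnj norm_of_real_1_plus_square)
  show eq: "(l2_norm vol (psi vol p \<Phi> E \<kappa> \<sigma> I \<mu>))\<^sup>2 = zeta p \<Phi> E I 2 \<mu> +
      \<sigma>\<^sup>2 * (\<Sum>\<^sub>\<infinity>j\<in>{j. E j \<notin> I}. (E j - \<kappa>)\<^sup>2 * ((cmod (\<Phi> j p))\<^sup>2 / (1 + (E j)\<^sup>2)\<^sup>2))"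
    using sum unfolding compl 1 2 .
  have "zeta p \<Phi> E I 2 \<mu> > 0"
    unfolding zeta_finite[OF I(1)]
  proof (rule sum_pos[OF K])
    show "?K \<noteq> {}" using I(2) by auto
    fix j assume "j \<in> ?K"
    then have "E j - \<mu> \<noteq> 0" using \<mu> by auto
    then show "0 < (cmod (\<Phi> j p))\<^sup>2 / (E j - \<mu>)\<^sup>2" using Phi_nonzero by simp
  qed
  moreover have "(\<Sum>\<^sub>\<infinity>j\<in>{j. E j \<notin> I}. (E j - \<kappa>)\<^sup>2 * ((cmod (\<Phi> j p))\<^sup>2 / (1 + (E j)\<^sup>2)\<^sup>2)) \<ge> 0"
    by (intro infsum_nonneg) simp
  ultimately have "(l2_norm vol (psi vol p \<Phi> E \<kappa> \<sigma> I \<mu>))\<^sup>2 > 0"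
    unfolding eq by (intro add_pos_nonneg mult_nonneg_nonneg) auto
  then show "l2_norm vol (psi vol p \<Phi> E \<kappa> \<sigma> I \<mu>) > 0"
    using l2_norm_nonneg[of vol "psi vol p \<Phi> E \<kappa> \<sigma> I \<mu>"] by (simp add: order.order_iff_strict)
qed

lemma psi_quasimode:
  assumes \<Theta>: "\<Theta> \<in> {0<..<2 * pi}" and \<kappa>: "\<kappa> = sin \<Theta> / (1 - cos \<Theta>)"
    and I: "bounded I" "\<exists>j. E j \<in> I" and \<mu>: "\<mu> \<notin> {E j | j. E j \<in> I}"
    and root: "zeta p \<Phi> E I 1 \<mu> =
      \<sigma> * (\<Sum>\<^sub>\<infinity>j\<in>{j. E j \<in> I}. (E j - \<kappa>) * ((cmod (\<Phi> j p))\<^sup>2 / (1 + (E j)\<^sup>2)))"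
  shows "quasimode vol (H_Theta M vol Lap p \<Phi> E \<Theta>) (psi vol p \<Phi> E \<kappa> \<sigma> I \<mu>) \<mu>
    (sqrt (((1 - \<sigma>)\<^sup>2 * zeta p \<Phi> E I 0 \<mu> +
            \<sigma>\<^sup>2 * (\<Sum>\<^sub>\<infinity>j\<in>{j. E j \<notin> I}.
              (1 + E j * \<mu> + \<kappa> * (E j - \<mu>))\<^sup>2 * ((cmod (\<Phi> j p))\<^sup>2 / (1 + (E j)\<^sup>2)\<^sup>2)))
           / (zeta p \<Phi> E I 2 \<mu> +
            \<sigma>\<^sup>2 * (\<Sum>\<^sub>\<infinity>j\<in>{j. E j \<notin> I}.
              (E j - \<kappa>)\<^sup>2 * ((cmod (\<Phi> j p))\<^sup>2 / (1 + (E j)\<^sup>2)\<^sup>2)))))"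
proof -
  let ?K = "{j. E j \<in> I}" and ?\<psi> = "psi vol p \<Phi> E \<kappa> \<sigma> I \<mu>"
  note K = finite_bounded_eigenvalues[OF I(1)]
  have ne: "E j - \<mu> \<noteq> 0" if "j \<in> ?K" for j using that \<mu> by auto
  have pos: "1 + (E j)\<^sup>2 \<noteq> 0" for j using zero_le_power2[of "E j"] by linarith
  obtain a where a: "a - exp (\<i> * of_real \<Theta>) * a = of_real \<sigma>"
      "\<i> * (a + exp (\<i> * of_real \<Theta>) * a) = - of_real (\<kappa> * \<sigma>)"
    using scattering_phase[OF \<Theta> \<kappa>] by blast
  define b where b: "b = - exp (\<i> * of_real \<Theta>) * a"
  have ab: "a + b = of_real \<sigma>" "\<i> * (a - b) = - of_real (\<kappa> * \<sigma>)"
    using a by (simp_all add: b)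
  (* The component of psi in D_p: it is supported on I, and it vanishes at p by the equation for mu. *)
  define r where "r j = 1 / (E j - \<mu>) - \<sigma> * (E j - \<kappa>) / (1 + (E j)\<^sup>2)" for j
  define c where "c j = cnj (\<Phi> j p) * of_real (r j)" for j
  have c_p: "(\<Sum>j\<in>?K. c j * \<Phi> j p) = 0"
  proof -
    have "(\<Sum>j\<in>?K. c j * \<Phi> j p) = of_real (\<Sum>j\<in>?K. r j * (cmod (\<Phi> j p))\<^sup>2)"
      unfolding of_real_sum of_real_mult complex_norm_square c_def by (simp add: mult_ac)
    also have "(\<Sum>j\<in>?K. r j * (cmod (\<Phi> j p))\<^sup>2) = zeta p \<Phi> E I 1 \<mu> -
        \<sigma> * (\<Sum>j\<in>?K. (E j - \<kappa>) * ((cmod (\<Phi> j p))\<^sup>2 / (1 + (E j)\<^sup>2)))"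
      unfolding zeta_finite[OF I(1)] sum_distrib_left sum_subtractf[symmetric]
      by (simp add: r_def divide_inverse algebra_simps)
    finally show ?thesis using root K by simp
  qed
  let ?G = "greens vol p \<Phi> E"
  define h where "h x = (\<Sum>j\<in>?K. of_real (E j) * c j * \<Phi> j x) + a * (\<i> * ?G \<i> x) + b * (- \<i> * ?G (- \<i>) x)" for x
  have \<psi>_l2: "?\<psi> \<in> l2 vol" using has_l2_sum_l2[OF has_l2_sum_psi[OF I(1)]] .
  have "has_l2_sum vol (\<lambda>j x. (if j \<in> ?K then c j else 0) * \<Phi> j x +
      ((a + b) * of_real (E j) + \<i> * (a - b)) * (cnj (\<Phi> j p) / of_real (1 + (E j)\<^sup>2)) * \<Phi> j x) UNIV
      (\<lambda>x. (\<Sum>j\<in>?K. c j * \<Phi> j x) + (a * ?G \<i> x + b * ?G (- \<i>) x))"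
    by (rule has_l2_sum_add[OF has_l2_sum_finite_support[OF Phi_orthonormal K] has_l2_sum_greens_combination])
      (simp_all only: l2_cmult Phi_l2)
  then have decomp: "has_l2_sum vol (\<lambda>j x. (if E j \<in> I then cnj (\<Phi> j p) / of_real (E j - \<mu>)
      else of_real \<sigma> * (of_real (E j - \<kappa>) * (cnj (\<Phi> j p) / of_real (1 + (E j)\<^sup>2)))) * \<Phi> j x) UNIV
      (\<lambda>x. (\<Sum>j\<in>?K. c j * \<Phi> j x) + (a * ?G \<i> x + b * ?G (- \<i>) x))"
  proof (rule has_l2_sum_cong)
    fix j x
    have "(a + b) * of_real (E j) + \<i> * (a - b) = of_real (\<sigma> * (E j - \<kappa>))"
      unfolding ab by (simp add: algebra_simps)
    then have w: "((a + b) * of_real (E j) + \<i> * (a - b)) * (cnj (\<Phi> j p) / of_real (1 + (E j)\<^sup>2)) =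
        cnj (\<Phi> j p) * of_real (\<sigma> * (E j - \<kappa>) / (1 + (E j)\<^sup>2))"
      by (simp only: of_real_divide) (simp only: times_divide_eq_right mult.commute)
    have "c j + cnj (\<Phi> j p) * of_real (\<sigma> * (E j - \<kappa>) / (1 + (E j)\<^sup>2)) = cnj (\<Phi> j p) / of_real (E j - \<mu>)"
      unfolding c_def r_def distrib_left[symmetric] of_real_add[symmetric] by simp
    moreover have "cnj (\<Phi> j p) * of_real (\<sigma> * (E j - \<kappa>) / (1 + (E j)\<^sup>2)) =
        of_real \<sigma> * (of_real (E j - \<kappa>) * (cnj (\<Phi> j p) / of_real (1 + (E j)\<^sup>2)))"
      by (simp only: of_real_divide of_real_mult times_divide_eq_right mult_ac)
    ultimately show "(if j \<in> ?K then c j else 0) * \<Phi> j x +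
      ((a + b) * of_real (E j) + \<i> * (a - b)) * (cnj (\<Phi> j p) / of_real (1 + (E j)\<^sup>2)) * \<Phi> j x =
      (if E j \<in> I then cnj (\<Phi> j p) / of_real (E j - \<mu>)
      else of_real \<sigma> * (of_real (E j - \<kappa>) * (cnj (\<Phi> j p) / of_real (1 + (E j)\<^sup>2)))) * \<Phi> j x"
      unfolding w distrib_right[symmetric] by (cases "E j \<in> I") (simp_all only: mem_Collect_eq if_True if_False add_0)
  qed
  \<comment> \<open>Both series have the same coefficients, so \<open>psi\<close> agrees almost
    everywhere with its decomposition; \<open>H_Theta\<close> asks for no more.\<close>
  have "AE x in vol. ?\<psi> x = (\<Sum>j\<in>?K. c j * \<Phi> j x) + (a * ?G \<i> x + b * ?G (- \<i>) x)"
    by (rule has_l2_sum_unique[OF has_l2_sum_psi[OF I(1)] decomp]) (intro l2_cmult Phi_l2)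
  then have "AE x in vol. ?\<psi> x = (\<Sum>j\<in>?K. c j * \<Phi> j x) + a * ?G \<i> x + b * ?G (- \<i>) x"
    by (simp only: add.assoc)
  from H_Theta_memI[OF K c_p b \<psi>_l2 this] have mem: "(?\<psi>, h) \<in> H_Theta M vol Lap p \<Phi> E \<Theta>"
    by (simp only: h_def[abs_def])
  \<comment> \<open>Coefficients of h - \<mu> \<psi>. On \<open>I\<close> they come from E r -
    \<sigma> (1 + \<kappa> E) / (1 + E^2) - \<mu> / (E - \<mu>), which equals 1 - \<sigma>. Off
    \<open>I\<close> the numerators 1 + \<kappa> E and \<mu> (E - \<kappa>) add up to the factor in
    the discrepancy.\<close>
  define R where "R j = (if E j \<in> I then cnj (\<Phi> j p) * of_real (1 - \<sigma>)
      else - of_real \<sigma> * (of_real (1 + E j * \<mu> + \<kappa> * (E j - \<mu>)) * (cnj (\<Phi> j p) / of_real (1 + (E j)\<^sup>2))))" for j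
  have "has_l2_sum vol (\<lambda>j x. (if j \<in> ?K then of_real (E j) * c j else 0) * \<Phi> j x +
      ((a * \<i> + b * - \<i>) * of_real (E j) + \<i> * (a * \<i> - b * - \<i>)) * (cnj (\<Phi> j p) / of_real (1 + (E j)\<^sup>2)) * \<Phi> j x +
      - of_real \<mu> * ((if E j \<in> I then cnj (\<Phi> j p) / of_real (E j - \<mu>)
      else of_real \<sigma> * (of_real (E j - \<kappa>) * (cnj (\<Phi> j p) / of_real (1 + (E j)\<^sup>2)))) * \<Phi> j x)) UNIV
      (\<lambda>x. (\<Sum>j\<in>?K. of_real (E j) * c j * \<Phi> j x) + (a * \<i> * ?G \<i> x + b * - \<i> * ?G (- \<i>) x) + - of_real \<mu> * ?\<psi> x)"
    by (rule has_l2_sum_add[OF has_l2_sum_add[OF has_l2_sum_finite_support[OF Phi_orthonormal K]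
          has_l2_sum_greens_combination] has_l2_sum_cmult[OF has_l2_sum_psi[OF I(1)]]])
      (intro l2_add l2_cmult Phi_l2)+
  then have "has_l2_sum vol (\<lambda>j x. R j * \<Phi> j x) UNIV
      (\<lambda>x. (\<Sum>j\<in>?K. of_real (E j) * c j * \<Phi> j x) + (a * \<i> * ?G \<i> x + b * - \<i> * ?G (- \<i>) x) + - of_real \<mu> * ?\<psi> x)"
  proof (rule has_l2_sum_cong)
    fix j x
    have "(a * \<i> + b * - \<i>) * of_real (E j) + \<i> * (a * \<i> - b * - \<i>) = \<i> * (a - b) * of_real (E j) - (a + b)"
      by (simp add: algebra_simps)
    also have "\<dots> = of_real (- \<sigma> * (\<kappa> * E j + 1))"
      unfolding ab by (simp add: algebra_simps)
    finally have "((a * \<i> + b * - \<i>) * of_real (E j) + \<i> * (a * \<i> - b * - \<i>)) * (cnj (\<Phi> j p) / of_real (1 + (E j)\<^sup>2)) =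
        of_real (- \<sigma> * (\<kappa> * E j + 1)) * (cnj (\<Phi> j p) / of_real (1 + (E j)\<^sup>2))" by (simp only:)
    also have "\<dots> = cnj (\<Phi> j p) * of_real (- \<sigma> * (\<kappa> * E j + 1) / (1 + (E j)\<^sup>2))"
      by (simp only: of_real_divide times_divide_eq_right mult.commute)
    finally have w: "((a * \<i> + b * - \<i>) * of_real (E j) + \<i> * (a * \<i> - b * - \<i>)) * (cnj (\<Phi> j p) / of_real (1 + (E j)\<^sup>2)) =
        cnj (\<Phi> j p) * of_real (- \<sigma> * (\<kappa> * E j + 1) / (1 + (E j)\<^sup>2))" .
    let ?d = "if E j \<in> I then cnj (\<Phi> j p) / of_real (E j - \<mu>)
      else of_real \<sigma> * (of_real (E j - \<kappa>) * (cnj (\<Phi> j p) / of_real (1 + (E j)\<^sup>2)))"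
    have "(if j \<in> ?K then of_real (E j) * c j else 0) +
        cnj (\<Phi> j p) * of_real (- \<sigma> * (\<kappa> * E j + 1) / (1 + (E j)\<^sup>2)) + - of_real \<mu> * ?d = R j"
    proof (cases "E j \<in> I")
      case True
      have "E j * r j + - \<sigma> * (\<kappa> * E j + 1) / (1 + (E j)\<^sup>2) + - \<mu> * (1 / (E j - \<mu>)) = 1 - \<sigma>"
      proof -
        \<comment> \<open>Here m and q stand for the reciprocals of E - \<mu> and 1 + E^2. Division
          is postponed until after a purely polynomial identity.\<close>
        have "E j * (1 * m - \<sigma> * (E j - \<kappa>) * q) + - \<sigma> * (\<kappa> * E j + 1) * q + - \<mu> * (1 * m) =
            (E j - \<mu>) * m - \<sigma> * ((1 + (E j)\<^sup>2) * q)" for m q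
          by (simp add: algebra_simps power2_eq_square)
        then show ?thesis
          unfolding r_def divide_inverse using ne[of j] pos[of j] True by simp
      qed
      then have "cnj (\<Phi> j p) * of_real (E j * r j + - \<sigma> * (\<kappa> * E j + 1) / (1 + (E j)\<^sup>2) + - \<mu> * (1 / (E j - \<mu>))) = R j"
        using True by (simp only: R_def if_True)
      then show ?thesis
        using True by (simp only: c_def mem_Collect_eq if_True of_real_add of_real_mult of_real_divide of_real_1 of_real_minus
          distrib_left mult_1_left mult_1_right times_divide_eq_right mult_ac)
    next
      case False
      have "- \<sigma> * (\<kappa> * E j + 1) / (1 + (E j)\<^sup>2) + - \<mu> * (\<sigma> * (E j - \<kappa>) / (1 + (E j)\<^sup>2)) =
          - \<sigma> * (1 + E j * \<mu> + \<kappa> * (E j - \<mu>)) / (1 + (E j)\<^sup>2)"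
        by (simp add: divide_inverse algebra_simps)
      then have "cnj (\<Phi> j p) * of_real (- \<sigma> * (\<kappa> * E j + 1) / (1 + (E j)\<^sup>2) + - \<mu> * (\<sigma> * (E j - \<kappa>) / (1 + (E j)\<^sup>2))) =
          cnj (\<Phi> j p) * of_real (- \<sigma> * (1 + E j * \<mu> + \<kappa> * (E j - \<mu>)) / (1 + (E j)\<^sup>2))"
        by (simp only:)
      moreover have "cnj (\<Phi> j p) * of_real (- \<sigma> * (1 + E j * \<mu> + \<kappa> * (E j - \<mu>)) / (1 + (E j)\<^sup>2)) = R j"
        using False by (simp only: R_def if_False of_real_mult of_real_divide of_real_minus times_divide_eq_right mult_ac)
      moreover have "- of_real \<mu> * ?d = cnj (\<Phi> j p) * of_real (- \<mu> * (\<sigma> * (E j - \<kappa>) / (1 + (E j)\<^sup>2)))"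
        using False by (simp only: if_False of_real_mult of_real_divide of_real_minus times_divide_eq_right mult_ac)
      ultimately show ?thesis
        using False by (simp only: mem_Collect_eq if_False of_real_add distrib_left add_0)
    qed
    then show "(if j \<in> ?K then of_real (E j) * c j else 0) * \<Phi> j x +
      ((a * \<i> + b * - \<i>) * of_real (E j) + \<i> * (a * \<i> - b * - \<i>)) * (cnj (\<Phi> j p) / of_real (1 + (E j)\<^sup>2)) * \<Phi> j x +
      - of_real \<mu> * (?d * \<Phi> j x) = R j * \<Phi> j x"
      unfolding w mult.assoc[symmetric] distrib_right[symmetric] by (simp only:)
  qed
  moreover have "(\<lambda>x. (\<Sum>j\<in>?K. of_real (E j) * c j * \<Phi> j x) + (a * \<i> * ?G \<i> x + b * - \<i> * ?G (- \<i>) x) + - of_real \<mu> * ?\<psi> x)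
      = (\<lambda>x. h x - of_real \<mu> * ?\<psi> x)"
    by (simp add: h_def fun_eq_iff mult.assoc)
  ultimately have res: "has_l2_sum vol (\<lambda>j x. R j * \<Phi> j x) UNIV (\<lambda>x. h x - of_real \<mu> * ?\<psi> x)" by (simp only:)
  have compl: "- ?K = {j. E j \<notin> I}" by auto
  have 1: "(\<Sum>j\<in>?K. (cmod (R j))\<^sup>2) = (1 - \<sigma>)\<^sup>2 * zeta p \<Phi> E I 0 \<mu>"
    unfolding zeta_finite[OF I(1)] sum_distrib_left
    by (rule sum.cong) (simp_all only: R_def mem_Collect_eq if_True norm_mult norm_of_real power_mult_distrib power2_abs
      complex_mod_cnj power_0 div_by_1 mult.commute)
  have 2: "(\<Sum>\<^sub>\<infinity>j\<in>{j. E j \<notin> I}. (cmod (R j))\<^sup>2) =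
      \<sigma>\<^sup>2 * (\<Sum>\<^sub>\<infinity>j\<in>{j. E j \<notin> I}. (1 + E j * \<mu> + \<kappa> * (E j - \<mu>))\<^sup>2 * ((cmod (\<Phi> j p))\<^sup>2 / (1 + (E j)\<^sup>2)\<^sup>2))"
    unfolding infsum_cmult_right'[symmetric]
    by (rule infsum_cong) (simp_all only: R_def mem_Collect_eq if_False norm_divide norm_mult norm_minus_cancel norm_of_real power_divide
      power_mult_distrib power2_abs complex_mod_cnj norm_of_real_1_plus_square)
  have num: "(l2_norm vol (\<lambda>x. h x - of_real \<mu> * ?\<psi> x))\<^sup>2 = (1 - \<sigma>)\<^sup>2 * zeta p \<Phi> E I 0 \<mu> +
      \<sigma>\<^sup>2 * (\<Sum>\<^sub>\<infinity>j\<in>{j. E j \<notin> I}. (1 + E j * \<mu> + \<kappa> * (E j - \<mu>))\<^sup>2 * ((cmod (\<Phi> j p))\<^sup>2 / (1 + (E j)\<^sup>2)\<^sup>2))"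
    using has_sum_split_finite[OF has_l2_sum_Parseval[OF Phi_orthonormal res] K] unfolding compl 1 2 .
  show ?thesis
    \<comment> \<open>Read backwards, the two Parseval formulas turn d into the quotient of the
      residual norm by the norm of \<psi>.\<close>
    unfolding quasimode_def num[symmetric] l2_norm_psi(1)[OF I \<mu>, symmetric]
  proof (intro exI[of _ h] conjI mem)
    show "l2_norm vol (\<lambda>x. h x - of_real \<mu> * ?\<psi> x) \<le>
        sqrt ((l2_norm vol (\<lambda>x. h x - of_real \<mu> * ?\<psi> x))\<^sup>2 / (l2_norm vol ?\<psi>)\<^sup>2) * l2_norm vol ?\<psi>"
      using l2_norm_psi(2)[OF I \<mu>, of \<kappa> \<sigma>] by (simp add: real_sqrt_divide l2_norm_nonneg)
  qed
qed

text \<open>Both functions share the same tail s, which is orthogonal to the parts on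
  \<open>I\<close>. Those parts are orthogonal to each other by the root equations, whose common
  right-hand side enters through equality of the two zeta values; what remains is \<sigma>^2 times
  the squared norm of s.\<close>

lemma l2_inner_psi:
  assumes I: "bounded I" and neq: "\<mu>\<^sub>1 \<noteq> \<mu>\<^sub>2"
    and \<mu>: "\<mu>\<^sub>1 \<notin> {E j | j. E j \<in> I}" "\<mu>\<^sub>2 \<notin> {E j | j. E j \<in> I}"
    and zeta: "zeta p \<Phi> E I 1 \<mu>\<^sub>1 = zeta p \<Phi> E I 1 \<mu>\<^sub>2"
  shows "l2_inner vol (psi vol p \<Phi> E \<kappa> \<sigma> I \<mu>\<^sub>1) (psi vol p \<Phi> E \<kappa> \<sigma> I \<mu>\<^sub>2) =
    of_real (\<sigma>\<^sup>2 * (\<Sum>\<^sub>\<infinity>j\<in>{j. E j \<notin> I}. (E j - \<kappa>)\<^sup>2 * ((cmod (\<Phi> j p))\<^sup>2 / (1 + (E j)\<^sup>2)\<^sup>2)))"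
proof -
  let ?K = "{j. E j \<in> I}"
  note K = finite_bounded_eigenvalues[OF I]
  define P where "P \<mu> x = (\<Sum>j\<in>?K. cnj (\<Phi> j p) / of_real (E j - \<mu>) * \<Phi> j x)" for \<mu> x
  define d where "d j = of_real (E j - \<kappa>) * (cnj (\<Phi> j p) / of_real (1 + (E j)\<^sup>2))" for j
  define s where "s = l2_infsum vol (\<lambda>j x. d j * \<Phi> j x) {j. E j \<notin> I}"
  have psi: "psi vol p \<Phi> E \<kappa> \<sigma> I \<mu> = (\<lambda>x. P \<mu> x + of_real \<sigma> * s x)" for \<mu>
    by (simp only: psi_def P_def s_def d_def)
  have s: "has_l2_sum vol (\<lambda>j x. d j * \<Phi> j x) {j. E j \<notin> I} s"
    using has_l2_sum_psi_tail[OF I] by (simp only: s_def d_def)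
  note sl = has_l2_sum_l2[OF s]
  have P: "P \<mu> \<in> l2 vol" for \<mu>
    unfolding P_def by (intro l2_sum l2_cmult Phi_l2)
  have sP: "l2_inner vol s (P \<mu>) = 0" for \<mu>
    unfolding P_def
    by (subst l2_inner_sum_right[OF l2_cmult[OF Phi_l2] sl])
      (unfold l2_inner_cmult_right has_l2_sum_coeff[OF Phi_orthonormal s], simp)
  have Ps: "l2_inner vol (P \<mu>) s = 0" for \<mu>
    using sP by (simp add: l2_inner_commute[of vol "P \<mu>" s])
  have "l2_inner vol (P \<mu>\<^sub>1) (P \<mu>\<^sub>2) =
      (\<Sum>j\<in>?K. cnj (\<Phi> j p) / of_real (E j - \<mu>\<^sub>1) * cnj (cnj (\<Phi> j p) / of_real (E j - \<mu>\<^sub>2)))"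
    unfolding P_def by (rule l2_inner_orthonormal_sums[OF Phi_orthonormal K])
  also have "\<dots> = of_real (\<Sum>j\<in>?K. ((cmod (\<Phi> j p))\<^sup>2 / (E j - \<mu>\<^sub>1) - (cmod (\<Phi> j p))\<^sup>2 / (E j - \<mu>\<^sub>2)) / (\<mu>\<^sub>1 - \<mu>\<^sub>2))"
    unfolding of_real_sum
  proof (rule sum.cong[OF refl])
    fix j assume "j \<in> ?K"
    then have ne: "E j - \<mu>\<^sub>1 \<noteq> 0" "E j - \<mu>\<^sub>2 \<noteq> 0" using \<mu> by auto
    have "cnj (\<Phi> j p) / of_real (E j - \<mu>\<^sub>1) * cnj (cnj (\<Phi> j p) / of_real (E j - \<mu>\<^sub>2)) =
        of_real ((cmod (\<Phi> j p))\<^sup>2 / ((E j - \<mu>\<^sub>1) * (E j - \<mu>\<^sub>2)))"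
      unfolding of_real_divide complex_norm_square by (simp add: mult.commute)
    \<comment> \<open>Partial fractions turn the product of the two resolvent factors into a
      difference quotient of the summands of zeta.\<close>
    also have "(cmod (\<Phi> j p))\<^sup>2 / ((E j - \<mu>\<^sub>1) * (E j - \<mu>\<^sub>2)) =
        ((cmod (\<Phi> j p))\<^sup>2 / (E j - \<mu>\<^sub>1) - (cmod (\<Phi> j p))\<^sup>2 / (E j - \<mu>\<^sub>2)) / (\<mu>\<^sub>1 - \<mu>\<^sub>2)"
    proof -
      have "\<mu>\<^sub>1 - \<mu>\<^sub>2 \<noteq> 0" using neq by simp
      moreover have "(cmod (\<Phi> j p))\<^sup>2 / (E j - \<mu>\<^sub>1) - (cmod (\<Phi> j p))\<^sup>2 / (E j - \<mu>\<^sub>2) =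
          (cmod (\<Phi> j p))\<^sup>2 * (\<mu>\<^sub>1 - \<mu>\<^sub>2) / ((E j - \<mu>\<^sub>1) * (E j - \<mu>\<^sub>2))"
        unfolding diff_frac_eq[OF ne] by (simp add: algebra_simps)
      ultimately show ?thesis by simp
    qed
    finally show "cnj (\<Phi> j p) / of_real (E j - \<mu>\<^sub>1) * cnj (cnj (\<Phi> j p) / of_real (E j - \<mu>\<^sub>2)) =
        of_real (((cmod (\<Phi> j p))\<^sup>2 / (E j - \<mu>\<^sub>1) - (cmod (\<Phi> j p))\<^sup>2 / (E j - \<mu>\<^sub>2)) / (\<mu>\<^sub>1 - \<mu>\<^sub>2))" .
  qed
  also have "(\<Sum>j\<in>?K. ((cmod (\<Phi> j p))\<^sup>2 / (E j - \<mu>\<^sub>1) - (cmod (\<Phi> j p))\<^sup>2 / (E j - \<mu>\<^sub>2)) / (\<mu>\<^sub>1 - \<mu>\<^sub>2)) =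
      (zeta p \<Phi> E I 1 \<mu>\<^sub>1 - zeta p \<Phi> E I 1 \<mu>\<^sub>2) / (\<mu>\<^sub>1 - \<mu>\<^sub>2)"
    unfolding zeta_finite[OF I] by (simp only: sum_divide_distrib sum_subtractf power_one_right diff_divide_distrib)
  finally have PP: "l2_inner vol (P \<mu>\<^sub>1) (P \<mu>\<^sub>2) = 0" using zeta by simp
  have "(l2_norm vol s)\<^sup>2 = (\<Sum>\<^sub>\<infinity>j\<in>{j. E j \<notin> I}. (cmod (d j))\<^sup>2)"
    using infsumI[OF has_l2_sum_Parseval[OF Phi_orthonormal s]] by simp
  also have "\<dots> = (\<Sum>\<^sub>\<infinity>j\<in>{j. E j \<notin> I}. (E j - \<kappa>)\<^sup>2 * ((cmod (\<Phi> j p))\<^sup>2 / (1 + (E j)\<^sup>2)\<^sup>2))"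
    by (rule infsum_cong) (simp only: d_def norm_divide norm_mult norm_of_real power_divide
      power_mult_distrib power2_abs complex_mod_cnj norm_of_real_1_plus_square)
  finally have ss: "l2_inner vol s s = of_real \<dots>" by (simp only: l2_inner_self)
  have "l2_inner vol (\<lambda>x. P \<mu>\<^sub>1 x + of_real \<sigma> * s x) (\<lambda>x. P \<mu>\<^sub>2 x + of_real \<sigma> * s x) =
      of_real \<sigma> * (of_real \<sigma> * l2_inner vol s s)"
    by (simp add: l2_inner_add_left l2_inner_add_right P sl l2_cmult l2_add l2_inner_cmult_left l2_inner_cmult_right
        PP sP Ps)
  then show ?thesis
    unfolding psi ss by (simp only: of_real_mult power2_eq_square mult.assoc)
qed

end

theorem theorem1p1:
  fixes atlas :: "('m::{t2_space, second_countable_topology}) chart set"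
    and G :: "'m chart \<Rightarrow> real^2 \<Rightarrow> real^2^2"
    and M :: "'m set" and vol :: "'m measure" and Lap :: "'m l2_operator" and p :: 'm
    and B :: "('m \<Rightarrow> complex) set" and \<Phi> :: "nat \<Rightarrow> 'm \<Rightarrow> complex" and E :: "nat \<Rightarrow> real"
    and \<Theta> \<kappa> \<sigma> :: real and I :: "real set"
  assumes "point_scatterer atlas G M vol Lap p B \<Phi> E"
    and "\<Theta> \<in> {0<..<2 * pi}"
    and "\<kappa> = sin \<Theta> / (1 - cos \<Theta>)"
    and "\<sigma> \<in> {0..1}"
    and "is_interval I" and "bounded I" and "\<exists>j. E j \<in> I"
  shows
    "(\<forall>\<mu>. \<mu> \<notin> {E j | j. E j \<in> I} \<longrightarrow>
        zeta p \<Phi> E I 1 \<mu> =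
          \<sigma> * (\<Sum>\<^sub>\<infinity>j\<in>{j. E j \<in> I}. (E j - \<kappa>) * ((cmod (\<Phi> j p))\<^sup>2 / (1 + (E j)\<^sup>2))) \<longrightarrow>
        quasimode vol (H_Theta M vol Lap p \<Phi> E \<Theta>) (psi vol p \<Phi> E \<kappa> \<sigma> I \<mu>) \<mu>
          (sqrt (((1 - \<sigma>)\<^sup>2 * zeta p \<Phi> E I 0 \<mu> +
                  \<sigma>\<^sup>2 * (\<Sum>\<^sub>\<infinity>j\<in>{j. E j \<notin> I}.
                    (1 + E j * \<mu> + \<kappa> * (E j - \<mu>))\<^sup>2 * ((cmod (\<Phi> j p))\<^sup>2 / (1 + (E j)\<^sup>2)\<^sup>2)))
                 / (zeta p \<Phi> E I 2 \<mu> +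
                  \<sigma>\<^sup>2 * (\<Sum>\<^sub>\<infinity>j\<in>{j. E j \<notin> I}.
                    (E j - \<kappa>)\<^sup>2 * ((cmod (\<Phi> j p))\<^sup>2 / (1 + (E j)\<^sup>2)\<^sup>2)))))) \<and>
     (\<forall>\<mu>\<^sub>1 \<mu>\<^sub>2. \<mu>\<^sub>1 \<noteq> \<mu>\<^sub>2 \<longrightarrow>
        (\<forall>\<mu>\<in>{\<mu>\<^sub>1, \<mu>\<^sub>2}. \<mu> \<notin> {E j | j. E j \<in> I} \<and>
          zeta p \<Phi> E I 1 \<mu> =
            \<sigma> * (\<Sum>\<^sub>\<infinity>j\<in>{j. E j \<in> I}. (E j - \<kappa>) * ((cmod (\<Phi> j p))\<^sup>2 / (1 + (E j)\<^sup>2)))) \<longrightarrow>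
        l2_inner vol (psi vol p \<Phi> E \<kappa> \<sigma> I \<mu>\<^sub>1) (psi vol p \<Phi> E \<kappa> \<sigma> I \<mu>\<^sub>2) =
          of_real (\<sigma>\<^sup>2 * (\<Sum>\<^sub>\<infinity>j\<in>{j. E j \<notin> I}.
            (E j - \<kappa>)\<^sup>2 * ((cmod (\<Phi> j p))\<^sup>2 / (1 + (E j)\<^sup>2)\<^sup>2))))"
proof -
  interpret point_scatterer atlas G M vol Lap p B \<Phi> E by (rule assms(1))
  show ?thesis
  proof (rule conjI; intro allI impI)
    fix \<mu>\<^sub>1 \<mu>\<^sub>2
    assume neq: "\<mu>\<^sub>1 \<noteq> \<mu>\<^sub>2" and *: "\<forall>\<mu>\<in>{\<mu>\<^sub>1, \<mu>\<^sub>2}. \<mu> \<notin> {E j | j. E j \<in> I} \<and>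
          zeta p \<Phi> E I 1 \<mu> =
            \<sigma> * (\<Sum>\<^sub>\<infinity>j\<in>{j. E j \<in> I}. (E j - \<kappa>) * ((cmod (\<Phi> j p))\<^sup>2 / (1 + (E j)\<^sup>2)))"
    from *[rule_format, of "\<mu>\<^sub>1"] *[rule_format, of "\<mu>\<^sub>2"]
    show "l2_inner vol (psi vol p \<Phi> E \<kappa> \<sigma> I \<mu>\<^sub>1) (psi vol p \<Phi> E \<kappa> \<sigma> I \<mu>\<^sub>2) =
          of_real (\<sigma>\<^sup>2 * (\<Sum>\<^sub>\<infinity>j\<in>{j. E j \<notin> I}.
            (E j - \<kappa>)\<^sup>2 * ((cmod (\<Phi> j p))\<^sup>2 / (1 + (E j)\<^sup>2)\<^sup>2)))"
      by (intro l2_inner_psi[OF assms(6) neq]) (simp_all only: insert_iff simp_thms)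
  qed (rule psi_quasimode[OF assms(2,3,6,7)])
qed

end
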